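(* Assume that: (i) for each $i$, $X_i$ is convex, $f_i$ and every component of $g_i$ are convex on $X_i$, $h_i$ is affine on $X_i$, and problem (CC) has at least one optimal solution; (ii) (Slater) there exist $\tilde x_i\in\mathrm{relint}\,X_i$, $i=1,\dots,N$, with $\sum_{i=1}^N g_i(\tilde x_i)<\mathbf 0_m$ (componentwise) and $\sum_{i=1}^N h_i(\tilde x_i)=\mathbf 0_p$; (iii) $P_A,P_H,P_{\tilde H}\in\mathbb R^{N\times N}$ are symmetric positive semidefinite with $P_A+\rho P_H\succ 0$, $P_H\succeq P_{\tilde H}$ and $\mathrm{Null}(P_H)=\mathrm{Null}(P_{\tilde H})=\mathrm{span}(\mathbf 1_N)$; (iv) each $X_i$ is compact; (v) $P_A+\rho P_H$ is diagonal. Let $\{\mathbf x^k\}_{k\ge1},\{\mathbf y^k\}_{k\ge0},\{\mathbf z^k\}_{k\ge0}$ be generated by DUCA. Then for all $k\ge1$, $$\left\|\begin{bmatrix}\big[\sum_{i=1}^N g_i(\bar x_i^k)\big]_+\\ \sum_{i=1}^N h_i(\bar x_i^k)\end{bmatrix}\right\|\le \frac{\sqrt{N\lambda_1(P_A)}}{k}\Big(\|\mathbf y^0-\mathbf y^\star\|_A+\|\mathbf s^0-\mathbf s^\star\|_G\Big).$$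
   Context: Problem (CC): minimize $\sum_{i=1}^N f_i(x_i)$ over $x_i\in X_i\subseteq\mathbb R^{d_i}$, $i=1,\dots,N$, subject to $\sum_{i=1}^N g_i(x_i)\le\mathbf 0_m$ and $\sum_{i=1}^N h_i(x_i)=\mathbf 0_p$, where $f_i:\mathbb R^{d_i}\to\mathbb R$, $g_i:\mathbb R^{d_i}\to\mathbb R^m$, $h_i:\mathbb R^{d_i}\to\mathbb R^p$. Write $\mathbf x=[x_1^T,\dots,x_N^T]^T$, $X=X_1\times\dots\times X_N$, $f(\mathbf x)=\sum_i f_i(x_i)$, $\tilde g(\mathbf x)=[g_1(x_1)^T,h_1(x_1)^T,\dots,g_N(x_N)^T,h_N(x_N)^T]^T\in\mathbb R^{N(m+p)}$. Under (i)-(ii) there exists a primal-dual optimal pair $(\mathbf x^\star,(\mu^\star,\lambda^\star))$ with $\mu^\star\in\mathbb R^m_+$, $\lambda^\star\in\mathbb R^p$: $\mathbf x^\star$ is optimal for (CC), $(\mu^\star,\lambda^\star)$ is optimal for the Lagrange dual (maximize $\inf_{\mathbf x\in X}f(\mathbf x)+\langle\mu,\sum_i g_i(x_i)\rangle+\langle\lambda,\sum_i h_i(x_i)\rangle$ over $\mu\in\mathbb R^m_+$, $\lambda\in\mathbb R^p$), there is zero duality gap, and $\mathbf x^\star\in\arg\min_{\mathbf x\in X}f(\mathbf x)+\langle\mu^\star,\sum_i g_i(x_i)\rangle+\langle\lambda^\star,\sum_i h_i(x_i)\rangle$. Fix such a pair. Vectors $\mathbf y\in\mathbb R^{N(m+p)}$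 are partitioned as $\mathbf y=[y_1^T,\dots,y_N^T]^T$, $y_i=[\mu_i^T,\lambda_i^T]^T$, $\mu_i\in\mathbb R^m$, $\lambda_i\in\mathbb R^p$; $\mathcal K=\{\mathbf y:\mu_i\in\mathbb R^m_+\ \forall i\}$. $\mathcal P_{\mathcal K}$ is Euclidean projection onto $\mathcal K$, $[\cdot]_+$ is the componentwise positive part. $\rho>0$ is a parameter; $A=P_A\otimes I_{m+p}$, $H=P_H\otimes I_{m+p}$, $\tilde H=P_{\tilde H}\otimes I_{m+p}$, $D=A+\rho H$. $\|\cdot\|$ is the Euclidean norm, $\|z\|_M=\sqrt{z^TMz}$ for symmetric positive semidefinite $M$, $M^\dagger$ is the Moore–Penrose pseudoinverse, $\lambda_1(\cdot)$ is the largest eigenvalue. DUCA: from arbitrary $\mathbf y^0\in\mathcal K$, $\mathbf z^0\in\mathbb R^{N(m+p)}$, for $k\ge0$: $\mathbf x^{k+1}\in\arg\min_{\mathbf x\in X}\{f(\mathbf x)+\frac12\|\mathcal P_{\mathcal K}[A\mathbf y^k-\tilde H^{1/2}\mathbf z^k+\tilde g(\mathbf x)]\|_{D^{-1}}^2\}$ (any minimizer); $\mathbf y^{k+1}=\mathcal P_{\mathcal K}[D^{-1}(A\mathbf y^k-\tilde H^{1/2}\mathbf z^k+\tilde g(\mathbf x^{k+1}))]$; $\mathbf z^{k+1}=\mathbf z^k+\rho\tilde H^{1/2}\mathbf y^{k+1}$. Further notation: $\mathbf y^\star=\mathbf 1_N\otimes[(\mu^\star)^T,(\lambda^\star)^T]^T$,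 $\mathbf z^\star=(\tilde H^{1/2})^\dagger\tilde g(\mathbf x^\star)$, $\mathbf s^k=[(\mathbf y^k)^T,(\mathbf z^k)^T]^T$, $\mathbf s^\star=[(\mathbf y^\star)^T,(\mathbf z^\star)^T]^T$, $G=\mathrm{diag}(A,I_{N(m+p)}/\rho)$ (block diagonal), $\bar{\mathbf x}^k=\frac1k\sum_{l=1}^k\mathbf x^l$ with blocks $\bar x_i^k$. *)

theory Defs
  imports "HOL-Analysis.Analysis"
begin

section \<open>Matrices\<close>

definition psd :: "real^'n^'n \<Rightarrow> bool" where
  "psd M \<longleftrightarrow> transpose M = M \<and> (\<forall>v. 0 \<le> v \<bullet> (M *v v))"

definition pos_def :: "real^'n^'n \<Rightarrow> bool" where
  "pos_def M \<longleftrightarrow> transpose M = M \<and> (\<forall>v. v \<noteq> 0 \<longrightarrow> 0 < v \<bullet> (M *v v))"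

definition diagonal :: "real^'n^'n \<Rightarrow> bool" where
  "diagonal M \<longleftrightarrow> (\<forall>i j. i \<noteq> j \<longrightarrow> M $ i $ j = 0)"

definition null_space :: "real^'n^'m \<Rightarrow> (real^'n) set" where
  "null_space M = {v. M *v v = 0}"

text \<open>The positive semidefinite square root; meaningful for positive semidefinite matrices,
  for which it exists and is unique.\<close>

definition psd_sqrt :: "real^'n^'n \<Rightarrow> real^'n^'n" where
  "psd_sqrt M = (THE S. psd S \<and> S ** S = M)"

text \<open>The Moore--Penrose pseudoinverse, given by the four Penrose equations, which have exactly one
  solution for every real matrix.\<close>

definition pinv :: "real^'n^'m \<Rightarrow> real^'m^'n" where
  "pinv M = (THE B. M ** B ** M = M \<and> B ** M ** B = B \<and>
                    transpose (M ** B) = M ** B \<and> transpose (B ** M) = B ** M)"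

text \<open>Intended for symmetric matrices, which have at least one real eigenvalue.\<close>

definition largest_eigenvalue :: "real^'n^'n \<Rightarrow> real" where
  "largest_eigenvalue M = Max {c. \<exists>v. v \<noteq> 0 \<and> M *v v = c *\<^sub>R v}"

definition wnorm :: "real^'n^'n \<Rightarrow> real^'n \<Rightarrow> real" where
  "wnorm M v = sqrt (v \<bullet> (M *v v))"

definition kron :: "real^'b^'a \<Rightarrow> real^'d^'c \<Rightarrow> real^('b \<times> 'd)^('a \<times> 'c)" where
  "kron P Q = (\<chi> r s. P $ fst r $ fst s * Q $ snd r $ snd s)"

definition block_diag :: "real^'a^'a \<Rightarrow> real^'b^'b \<Rightarrow> real^('a + 'b)^('a + 'b)" where
  "block_diag M M' = (\<chi> r s. case (r, s) of
      (Inl i, Inl j) \<Rightarrow> M $ i $ j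
    | (Inr i, Inr j) \<Rightarrow> M' $ i $ j
    | _ \<Rightarrow> 0)"

section \<open>Stacked vectors\<close>

text \<open>The vector with upper part \<open>u\<close> and lower part \<open>v\<close>.\<close>

definition stack :: "real^'a \<Rightarrow> real^'b \<Rightarrow> real^('a + 'b)" where
  "stack u v = (\<chi> q. case q of Inl j \<Rightarrow> u $ j | Inr l \<Rightarrow> v $ l)"

text \<open>The vector whose \<open>i\<close>-th block is \<open>w i\<close>. The index type \<open>'n \<times> 'a\<close> matches that of
  \<open>kron P (mat 1)\<close> for an \<open>'n\<close>-indexed matrix \<open>P\<close>.\<close>

definition blocks :: "('n::finite \<Rightarrow> real^'a) \<Rightarrow> real^('n \<times> 'a)" where
  "blocks w = (\<chi> q. w (fst q) $ snd q)"

definition pos_part :: "real^'m \<Rightarrow> real^'m" where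
  "pos_part v = (\<chi> j. max 0 (v $ j))"

section \<open>The constraint-coupled problem\<close>

text \<open>Agents are the elements of \<open>'n\<close>, with \<open>N = CARD('n)\<close>. The individual dimensions may differ:
  agent \<open>i\<close> owns a set \<open>J i\<close> of coordinates, and its space, of dimension \<open>card (J i)\<close>, is the
  coordinate subspace \<open>coord_space (J i)\<close> of \<open>real^'d\<close>. A decision \<open>x :: real^'d^'n\<close>
  has the blocks \<open>x $ i\<close>.\<close>

definition coord_space :: "'d set \<Rightarrow> (real^'d) set" where
  "coord_space I = {v. \<forall>j. j \<notin> I \<longrightarrow> v $ j = 0}"

text \<open>\<open>h\<close> is the restriction to \<open>S\<close> of an affine map.\<close>

definition affine_map_on :: "(real^'d) set \<Rightarrow> (real^'d \<Rightarrow> real^'p) \<Rightarrow> bool" where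
  "affine_map_on S h \<longleftrightarrow> (\<exists>L c. linear L \<and> (\<forall>v\<in>S. h v = L v + c))"

definition prod_set :: "('n \<Rightarrow> (real^'d) set) \<Rightarrow> (real^'d^'n) set" where
  "prod_set X = {x. \<forall>i. x $ i \<in> X i}"

definition tot :: "('n::finite \<Rightarrow> real^'d \<Rightarrow> 'b::comm_monoid_add) \<Rightarrow> real^'d^'n \<Rightarrow> 'b" where
  "tot f x = (\<Sum>i\<in>UNIV. f i (x $ i))"

definition feasible ::
  "('n::finite \<Rightarrow> (real^'d) set) \<Rightarrow> ('n \<Rightarrow> real^'d \<Rightarrow> real^'m) \<Rightarrow> ('n \<Rightarrow> real^'d \<Rightarrow> real^'p)
    \<Rightarrow> (real^'d^'n) set" where
  "feasible X g h = {x \<in> prod_set X. (\<forall>j. tot g x $ j \<le> 0) \<and> tot h x = 0}"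

definition optimal ::
  "('n::finite \<Rightarrow> (real^'d) set) \<Rightarrow> ('n \<Rightarrow> real^'d \<Rightarrow> real)
    \<Rightarrow> ('n \<Rightarrow> real^'d \<Rightarrow> real^'m) \<Rightarrow> ('n \<Rightarrow> real^'d \<Rightarrow> real^'p) \<Rightarrow> real^'d^'n \<Rightarrow> bool" where
  "optimal X f g h x \<longleftrightarrow> is_arg_min (tot f) (\<lambda>x. x \<in> feasible X g h) x"

definition lagrangian ::
  "('n::finite \<Rightarrow> real^'d \<Rightarrow> real) \<Rightarrow> ('n \<Rightarrow> real^'d \<Rightarrow> real^'m) \<Rightarrow> ('n \<Rightarrow> real^'d \<Rightarrow> real^'p)
    \<Rightarrow> real^'m \<Rightarrow> real^'p \<Rightarrow> real^'d^'n \<Rightarrow> real" where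
  "lagrangian f g h \<mu> \<nu> x = tot f x + \<mu> \<bullet> tot g x + \<nu> \<bullet> tot h x"

text \<open>Extended-real valued, so that an infimum of minus infinity is allowed.\<close>

definition dual_fun ::
  "('n::finite \<Rightarrow> (real^'d) set) \<Rightarrow> ('n \<Rightarrow> real^'d \<Rightarrow> real)
    \<Rightarrow> ('n \<Rightarrow> real^'d \<Rightarrow> real^'m) \<Rightarrow> ('n \<Rightarrow> real^'d \<Rightarrow> real^'p)
    \<Rightarrow> real^'m \<Rightarrow> real^'p \<Rightarrow> ereal" where
  "dual_fun X f g h \<mu> \<nu> = (INF x\<in>prod_set X. ereal (lagrangian f g h \<mu> \<nu> x))"

definition dual_optimal ::
  "('n::finite \<Rightarrow> (real^'d) set) \<Rightarrow> ('n \<Rightarrow> real^'d \<Rightarrow> real)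
    \<Rightarrow> ('n \<Rightarrow> real^'d \<Rightarrow> real^'m) \<Rightarrow> ('n \<Rightarrow> real^'d \<Rightarrow> real^'p)
    \<Rightarrow> real^'m \<Rightarrow> real^'p \<Rightarrow> bool" where
  "dual_optimal X f g h \<mu> \<nu> \<longleftrightarrow> (\<forall>j. 0 \<le> \<mu> $ j) \<and>
     (\<forall>\<mu>' \<nu>'. (\<forall>j. 0 \<le> \<mu>' $ j) \<longrightarrow> dual_fun X f g h \<mu>' \<nu>' \<le> dual_fun X f g h \<mu> \<nu>)"

definition primal_dual_optimal ::
  "('n::finite \<Rightarrow> (real^'d) set) \<Rightarrow> ('n \<Rightarrow> real^'d \<Rightarrow> real)
    \<Rightarrow> ('n \<Rightarrow> real^'d \<Rightarrow> real^'m) \<Rightarrow> ('n \<Rightarrow> real^'d \<Rightarrow> real^'p)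
    \<Rightarrow> real^'d^'n \<Rightarrow> real^'m \<Rightarrow> real^'p \<Rightarrow> bool" where
  "primal_dual_optimal X f g h x \<mu> \<nu> \<longleftrightarrow>
     optimal X f g h x \<and>
     dual_optimal X f g h \<mu> \<nu> \<and>
     dual_fun X f g h \<mu> \<nu> = ereal (tot f x) \<and>
     is_arg_min (lagrangian f g h \<mu> \<nu>) (\<lambda>x. x \<in> prod_set X) x"

section \<open>The algorithm\<close>

definition gtilde ::
  "('n::finite \<Rightarrow> real^'d \<Rightarrow> real^'m) \<Rightarrow> ('n \<Rightarrow> real^'d \<Rightarrow> real^'p) \<Rightarrow> real^'d^'n
    \<Rightarrow> real^('n \<times> ('m + 'p))" where
  "gtilde g h x = blocks (\<lambda>i. stack (g i (x $ i)) (h i (x $ i)))"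

definition Kset :: "(real^('n::finite \<times> ('m::finite + 'p::finite))) set" where
  "Kset = {y. \<forall>i j. 0 \<le> y $ (i, Inl j)}"

text \<open>The \<open>x\<close>-iterates are \<open>x 1, x 2, \<dots>\<close>; the value \<open>x 0\<close> is unconstrained and unused. The
  \<open>x\<close>-update may pick any minimiser.\<close>

definition duca ::
  "real \<Rightarrow> real^'n^'n \<Rightarrow> real^'n^'n \<Rightarrow> real^'n^'n
    \<Rightarrow> ('n::finite \<Rightarrow> (real^'d) set) \<Rightarrow> ('n \<Rightarrow> real^'d \<Rightarrow> real)
    \<Rightarrow> ('n \<Rightarrow> real^'d \<Rightarrow> real^'m) \<Rightarrow> ('n \<Rightarrow> real^'d \<Rightarrow> real^'p)
    \<Rightarrow> (nat \<Rightarrow> real^'d^'n) \<Rightarrow> (nat \<Rightarrow> real^('n \<times> ('m + 'p))) \<Rightarrow> (nat \<Rightarrow> real^('n \<times> ('m + 'p)))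
    \<Rightarrow> bool" where
  "duca \<rho> PA PH PHt X f g h x y z \<longleftrightarrow>
    (let A = kron PA (mat 1); H = kron PH (mat 1); Ht = kron PHt (mat 1);
         D = A + \<rho> *\<^sub>R H; R = psd_sqrt Ht; proj = closest_point Kset
     in y 0 \<in> Kset \<and>
        (\<forall>k. is_arg_min
               (\<lambda>u. tot f u
                  + (1/2) * (wnorm (matrix_inv D)
                       (proj (A *v y k - R *v z k + gtilde g h u)))\<^sup>2)
               (\<lambda>u. u \<in> prod_set X) (x (Suc k)) \<and>
             y (Suc k) = proj (matrix_inv D *v (A *v y k - R *v z k + gtilde g h (x (Suc k)))) \<and>
             z (Suc k) = z k + \<rho> *\<^sub>R (R *v y (Suc k))))"

definition running_avg :: "(nat \<Rightarrow> 'a::real_vector) \<Rightarrow> nat \<Rightarrow> 'a" where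
  "running_avg x k = (1 / real k) *\<^sub>R (\<Sum>l=1..k. x l)"

end

theory Submission
  imports Defs
begin

text \<open>
  Write \<open>s k\<close> for the pair of \<open>y k\<close> and \<open>z k\<close>. Its distance to the saddle point in the seminorm given
  by \<open>G\<close> does not increase: optimality of the primal step makes \<open>x (Suc k)\<close> a minimiser of \<open>tot f\<close>
  plus the inner product of \<open>y (Suc k)\<close> with \<open>gtilde\<close>, which is compared with the saddle point, while
  the dual step is a projection whose residual is normal to \<open>Kset\<close>. Summing this residual over the
  agents removes every term containing \<open>PH\<close> or \<open>PHt\<close>, since these vanish on consensus vectors, and
  bounds \<open>tot g (x (Suc k))\<close> by the agent sum of \<open>A (y (Suc k) - y k)\<close>, with equality for \<open>tot h\<close>.
  This telescopes over \<open>k\<close>, so by convexity the violation at the average is at most \<open>1/k\<close> times the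
  agent sum of \<open>A (y k - y 0)\<close>, which the triangle inequality and the monotone distance bound
  uniformly in \<open>k\<close>.
\<close>

section \<open>Spectral decomposition of symmetric matrices\<close>

text \<open>Divide by \<open>t\<close> and let \<open>t\<close> tend to 0. This is the first-order
  condition used for the Rayleigh maximiser and again for the primal minimiser.\<close>

lemma linear_coeff_nonneg:
  fixes a b :: real
  assumes "\<And>t. 0 < t \<Longrightarrow> t \<le> 1 \<Longrightarrow> 0 \<le> t * a + t\<^sup>2 * b"
  shows "0 \<le> a"
proof (rule ccontr)
  assume "\<not> 0 \<le> a"
  \<comment> \<open>With this choice \<open>t * (\<bar>b\<bar> + 1)\<close> is at most
    \<open>- a / 2\<close>, so the quadratic term cannot compensate a negative
    \<open>a\<close>.\<close>
  define t where "t = min 1 (- a / (2 * (\<bar>b\<bar> + 1)))"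
  have t: "0 < t" "t \<le> 1" using \<open>\<not> 0 \<le> a\<close> by (auto simp: t_def divide_neg_pos)
  have "t * (\<bar>b\<bar> + 1) \<le> - a / (2 * (\<bar>b\<bar> + 1)) * (\<bar>b\<bar> + 1)"
    by (intro mult_right_mono) (auto simp: t_def)
  also have "\<dots> = - a / 2" by (simp add: field_simps)
  finally have "t * \<bar>b\<bar> < - a" using t \<open>\<not> 0 \<le> a\<close> by (simp add: algebra_simps)
  moreover have "t * b \<le> t * \<bar>b\<bar>" using t by (intro mult_left_mono) auto
  ultimately have "t * (a + t * b) < 0" using t by (intro mult_pos_neg; linarith)
  moreover have "0 \<le> t * (a + t * b)"
    using assms[OF t] by (simp add: power2_eq_square algebra_simps)
  ultimately show False by simp
qed

lemma symmetric_inner: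
  fixes M :: "real^'n^'n"
  assumes "transpose M = M"
  shows "(M *v u) \<bullet> v = u \<bullet> (M *v v)"
  by (metis assms dot_lmul_matrix vector_transpose_matrix)

lemma matrix_symmetricI:
  fixes M :: "real^'n^'n"
  assumes "\<And>u v. (M *v u) \<bullet> v = u \<bullet> (M *v v)"
  shows "transpose M = M"
proof -
  have "transpose M *v u = M *v u" for u
  proof (rule vector_eq_rdot[THEN iffD1], rule allI)
    fix v show "(transpose M *v u) \<bullet> v = (M *v u) \<bullet> v"
      by (metis assms dot_lmul_matrix transpose_transpose vector_transpose_matrix)
  qed
  then show ?thesis by (simp add: matrix_eq)
qed

text \<open>Maximise the quadratic form over the unit sphere of \<open>S\<close>, which is compact.
  Invariance keeps the eigenvector residual of the maximiser inside \<open>S\<close>, where it is an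
  admissible direction of perturbation.\<close>

lemma invariant_subspace_eigenvector:
  fixes M :: "real^'n^'n"
  assumes sym: "transpose M = M" and S: "subspace S" and ne: "S \<noteq> {0}"
    and inv: "\<And>v. v \<in> S \<Longrightarrow> M *v v \<in> S"
  obtains v c where "v \<in> S" "norm v = 1" "M *v v = c *\<^sub>R v"
proof -
  obtain w where w: "w \<in> S" "w \<noteq> 0" using ne S subspace_0 by fastforce
  have "w /\<^sub>R norm w \<in> S \<inter> sphere 0 1"
    using w S by (simp add: subspace_scale)
  then have "S \<inter> sphere 0 1 \<noteq> {}" by blast
  moreover have "compact (S \<inter> sphere 0 1)"
    using S by (simp add: closed_Int_compact closed_subspace)
  moreover have "continuous_on (S \<inter> sphere 0 1) (\<lambda>v. v \<bullet> (M *v v))"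
    by (intro continuous_intros matrix_vector_mult_linear_continuous_on)
  ultimately obtain v where v: "v \<in> S" "norm v = 1"
    and max: "\<And>u. u \<in> S \<inter> sphere 0 1 \<Longrightarrow> u \<bullet> (M *v u) \<le> v \<bullet> (M *v v)"
    using continuous_attains_sup[of "S \<inter> sphere 0 1" "\<lambda>v. v \<bullet> (M *v v)"]
    by (metis (no_types, lifting) IntD1 IntD2 mem_sphere_0)
  define c where "c = v \<bullet> (M *v v)"
  have rayleigh: "u \<bullet> (M *v u) \<le> c * (u \<bullet> u)" if "u \<in> S" for u
  proof (cases "u = 0")
    case False
    define e where "e = u /\<^sub>R norm u"
    have "e \<bullet> (M *v e) \<le> c"
      unfolding c_def using that S False by (intro max) (simp add: subspace_scale e_def)
    moreover have "u = norm u *\<^sub>R e" using False by (simp add: e_def)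
    then have "u \<bullet> (M *v u) = (norm u)\<^sup>2 * (e \<bullet> (M *v e))"
      by (metis inner_scaleR_left inner_scaleR_right matrix_vector_mult_scaleR mult.assoc
          power2_eq_square)
    ultimately show ?thesis
      by (simp add: mult.commute[of c] mult_left_mono power2_norm_eq_inner)
  qed simp
  \<comment> \<open>Perturbing \<open>v\<close> by \<open>t *\<^sub>R w\<close> in the Rayleigh
    inequality gives a quadratic in \<open>t\<close> with linear coefficient
    \<open>- 2 * (w \<bullet> w)\<close>; the first-order condition then forces the residual
    \<open>w\<close> to vanish.\<close>
  define w where "w = M *v v - c *\<^sub>R v"
  have wS: "w \<in> S" using v S inv by (simp add: w_def subspace_diff subspace_scale)
  have vv: "v \<bullet> v = 1" using v by (simp add: norm_eq_1)
  have "0 \<le> t * (- 2 * (w \<bullet> w)) + t\<^sup>2 * (c * (w \<bullet> w) - w \<bullet> (M *v w))" for t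
  proof -
    have "w \<bullet> (M *v v) - c * (w \<bullet> v) = w \<bullet> w"
      by (subst (3) w_def) (simp add: inner_diff_right)
    moreover have "v \<bullet> (M *v w) = w \<bullet> (M *v v)"
      by (metis inner_commute sym symmetric_inner)
    moreover have "v + t *\<^sub>R w \<in> S" using v wS S by (simp add: subspace_add subspace_scale)
    note rayleigh[OF this]
    ultimately show ?thesis
      using vv by (simp add: matrix_vector_right_distrib matrix_vector_mult_scaleR inner_add_left
          inner_add_right power2_eq_square inner_commute[of v w] flip: c_def)
        (simp add: algebra_simps)
  qed
  then have "0 \<le> - 2 * (w \<bullet> w)" by (rule linear_coeff_nonneg)
  then have "w \<bullet> w = 0" using inner_ge_zero[of w] by linarith
  then have "w = 0" by simp
  then show thesis using that[of v c] v by (simp add: w_def)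
qed

section \<open>Functional calculus in an orthonormal eigenbasis\<close>

definition orthonormal_basis :: "(real^'n) set \<Rightarrow> bool" where
  "orthonormal_basis B \<longleftrightarrow>
     finite B \<and> (\<forall>b\<in>B. \<forall>b'\<in>B. b \<bullet> b' = (if b = b' then 1 else 0)) \<and> span B = UNIV"

text \<open>For an orthonormal basis \<open>B\<close>, matrix products become pointwise products of
  the coefficient functions, so roots and pseudoinverses reduce to real numbers.\<close>

definition spectral_matrix :: "(real^'n) set \<Rightarrow> (real^'n \<Rightarrow> real) \<Rightarrow> real^'n^'n" where
  "spectral_matrix B c = matrix (\<lambda>v. \<Sum>b\<in>B. (c b * (b \<bullet> v)) *\<^sub>R b)"

lemma spectral_matrix_apply: "spectral_matrix B c *v v = (\<Sum>b\<in>B. (c b * (b \<bullet> v)) *\<^sub>R b)"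
  unfolding spectral_matrix_def
  by (intro fun_cong[OF matrix_vector_mul(2)] linear_compose_sum ballI linearI)
    (simp_all add: inner_add_right algebra_simps)

lemma orthonormal_sum:
  assumes "finite B" "\<forall>b\<in>B. \<forall>b'\<in>B. b \<bullet> b' = (if b = b' then 1 else 0)" "b \<in> B"
  shows "(\<Sum>b'\<in>B. a b' * (b \<bullet> b')) = (a b :: real)"
proof -
  have "(\<Sum>b'\<in>B. a b' * (b \<bullet> b')) = (\<Sum>b'\<in>B. if b' = b then a b' else 0)"
    using assms by (intro sum.cong) auto
  also have "\<dots> = a b" using assms by simp
  finally show ?thesis .
qed

lemma orthonormal_basis_sum:
  assumes "orthonormal_basis B" "b \<in> B"
  shows "(\<Sum>b'\<in>B. a b' * (b \<bullet> b')) = (a b :: real)"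
  using assms orthonormal_sum unfolding orthonormal_basis_def by blast

lemma spectral_matrix_eigenvector:
  assumes "orthonormal_basis B" "b \<in> B"
  shows "spectral_matrix B c *v b = c b *\<^sub>R b"
proof -
  have "spectral_matrix B c *v b = (\<Sum>b'\<in>B. if b' = b then c b' *\<^sub>R b' else 0)"
    unfolding spectral_matrix_apply using assms
    by (intro sum.cong) (auto simp: orthonormal_basis_def)
  also have "\<dots> = c b *\<^sub>R b" using assms by (simp add: orthonormal_basis_def)
  finally show ?thesis .
qed

lemma orthonormal_expand:
  assumes "orthonormal_basis B"
  shows "(\<Sum>b\<in>B. (b \<bullet> v) *\<^sub>R b) = v"
proof -
  define r where "r = v - (\<Sum>b\<in>B. (b \<bullet> v) *\<^sub>R b)"
  have "b \<bullet> r = 0" if "b \<in> B" for b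
    using that by (simp add: r_def orthonormal_basis_sum[OF assms] inner_diff_right
        inner_sum_right)
  then have "orthogonal r b" if "b \<in> B" for b
    using that by (simp add: orthogonal_def inner_commute)
  moreover have "r \<in> span B"
    using assms by (simp add: orthonormal_basis_def)
  ultimately have "orthogonal r r" by (metis orthogonal_to_span)
  then show ?thesis by (simp add: orthogonal_self r_def)
qed

lemma inner_spectral_matrix:
  assumes "orthonormal_basis B" "b \<in> B"
  shows "b \<bullet> (spectral_matrix B c *v v) = c b * (b \<bullet> v)"
  by (simp add: spectral_matrix_apply orthonormal_basis_sum[OF assms] inner_sum_right)

lemma spectral_matrix_mult:
  assumes "orthonormal_basis B"
  shows "spectral_matrix B c ** spectral_matrix B d = spectral_matrix B (\<lambda>b. c b * d b)"
  by (simp add: matrix_eq inner_spectral_matrix[OF assms] mult.assoc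
      spectral_matrix_apply[of B c] spectral_matrix_apply[of B "\<lambda>b. c b * d b"]
      flip: matrix_vector_mul_assoc)

lemma spectral_matrix_symmetric: "transpose (spectral_matrix B c) = spectral_matrix B c"
  by (rule matrix_symmetricI)
    (simp add: spectral_matrix_apply inner_sum_left inner_sum_right inner_commute mult_ac)

lemma spectral_matrix_form: "v \<bullet> (spectral_matrix B c *v v) = (\<Sum>b\<in>B. c b * (b \<bullet> v)\<^sup>2)"
  by (simp add: spectral_matrix_apply inner_sum_right inner_commute power2_eq_square mult_ac)

lemma spectral_matrix_psd: "(\<And>b. b \<in> B \<Longrightarrow> 0 \<le> c b) \<Longrightarrow> psd (spectral_matrix B c)"
  by (simp add: psd_def spectral_matrix_symmetric spectral_matrix_form sum_nonneg)

text \<open>Take an orthonormal set of eigenvectors of greatest cardinality, which exists because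
  independence bounds the size by the dimension. By symmetry its orthogonal complement is invariant;
  were it nonzero, it would contain a further unit eigenvector, against maximality.\<close>

theorem spectral_theorem:
  fixes M :: "real^'n^'n"
  assumes sym: "transpose M = M"
  obtains B c where "orthonormal_basis B" "M = spectral_matrix B c"
proof -
  define P where "P B \<longleftrightarrow> finite B \<and> (\<forall>b\<in>B. \<forall>b'\<in>B. b \<bullet> b' = (if b = b' then 1 else 0))
    \<and> (\<forall>b\<in>B. \<exists>c. M *v b = c *\<^sub>R b)" for B
  have card: "card B \<le> CARD('n)" if "P B" for B
  proof -
    have "pairwise orthogonal B"
      using that by (auto simp: P_def pairwise_def orthogonal_def)
    moreover have "0 \<notin> B" using that unfolding P_def by (metis inner_zero_left zero_neq_one)
    ultimately show ?thesis
      using pairwise_orthogonal_independent independent_bound by fastforce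
  qed
  have "P {}" by (simp add: P_def)
  then obtain B where B: "P B" and maximal: "\<And>C. P C \<Longrightarrow> card C \<le> card B"
    using ex_has_greatest_nat[of P "{}" card "Suc CARD('n)"] card by (auto simp: less_Suc_eq_le)
  have fin: "finite B" and on: "\<forall>b\<in>B. \<forall>b'\<in>B. b \<bullet> b' = (if b = b' then 1 else 0)"
    and ev: "\<forall>b\<in>B. \<exists>c. M *v b = c *\<^sub>R b"
    using B[unfolded P_def, THEN conjunct1] B[unfolded P_def, THEN conjunct2, THEN conjunct1]
      B[unfolded P_def, THEN conjunct2, THEN conjunct2] .
  define S where "S = {v. \<forall>b\<in>B. b \<bullet> v = 0}"
  have S: "subspace S"
    by (auto simp: S_def subspace_def inner_add_right)
  have inv: "M *v v \<in> S" if "v \<in> S" for v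
  proof -
    have "b \<bullet> (M *v v) = 0" if b: "b \<in> B" for b
    proof -
      obtain c where "M *v b = c *\<^sub>R b" using ev b by blast
      then show ?thesis
        using symmetric_inner[OF sym, of b v] \<open>v \<in> S\<close> b by (simp add: S_def)
    qed
    then show ?thesis by (simp add: S_def)
  qed
  have S0: "S = {0}"
  proof (rule ccontr)
    assume "S \<noteq> {0}"
    from invariant_subspace_eigenvector[OF sym S this inv]
    obtain v c where v: "v \<in> S" "norm v = 1" "M *v v = c *\<^sub>R v" by metis
    then have "v \<notin> B" by (auto simp: S_def norm_eq_1)
    moreover have "P (insert v B)"
      using fin on ev v unfolding P_def
      by (intro conjI) (auto simp: S_def norm_eq_1 inner_commute)
    ultimately show False using maximal[of "insert v B"] fin by simp
  qed
  have "v \<in> span B" for v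
  proof -
    have "(\<Sum>b'\<in>B. (b' \<bullet> v) * (b \<bullet> b')) = b \<bullet> v" if "b \<in> B" for b
      using fin on that by (rule orthonormal_sum)
    then have "v - (\<Sum>b\<in>B. (b \<bullet> v) *\<^sub>R b) \<in> S"
      by (simp add: S_def inner_diff_right inner_sum_right)
    then have "v = (\<Sum>b\<in>B. (b \<bullet> v) *\<^sub>R b)" using S0 by simp
    then show ?thesis by (metis (no_types, lifting) span_base span_scale span_sum)
  qed
  then have onb: "orthonormal_basis B" using fin on by (auto simp: orthonormal_basis_def)
  define c where "c b = (SOME c. M *v b = c *\<^sub>R b)" for b
  have c: "M *v b = c b *\<^sub>R b" if "b \<in> B" for b
    unfolding c_def by (rule someI_ex) (rule bspec[OF ev that])
  have "M *v v = spectral_matrix B c *v v" for v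
  proof -
    have "M *v v = (\<Sum>b\<in>B. (b \<bullet> v) *\<^sub>R (M *v b))"
      by (subst orthonormal_expand[OF onb, of v, symmetric])
        (simp only: vec.linear_sum[OF matrix_vector_mul_linear_gen] matrix_vector_mult_scaleR)
    then show ?thesis by (simp add: spectral_matrix_apply c mult.commute)
  qed
  then have "M = spectral_matrix B c" by (simp add: matrix_eq)
  with onb show thesis by (rule that)
qed

section \<open>Eigenvalues and the largest-eigenvalue bound\<close>

lemma spectral_matrix_eigenvalues:
  assumes "orthonormal_basis B"
  shows "{a. \<exists>v. v \<noteq> 0 \<and> spectral_matrix B c *v v = a *\<^sub>R v} = c ` B" (is "?E = _")
proof (intro equalityI subsetI)
  fix a assume "a \<in> ?E"
  then obtain v where v: "v \<noteq> 0" "spectral_matrix B c *v v = a *\<^sub>R v" by auto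
  have "\<exists>b\<in>B. b \<bullet> v \<noteq> 0"
  proof (rule ccontr)
    assume "\<not> ?thesis"
    then show False using orthonormal_expand[OF assms, of v] v by simp
  qed
  then obtain b where b: "b \<in> B" "b \<bullet> v \<noteq> 0" by auto
  then have "a = c b" using inner_spectral_matrix[OF assms b(1), of c v] v by simp
  with b show "a \<in> c ` B" by auto
next
  fix a assume "a \<in> c ` B"
  then obtain b where b: "b \<in> B" "a = c b" by auto
  have "spectral_matrix B c *v b = c b *\<^sub>R b"
    by (rule spectral_matrix_eigenvector[OF assms b(1)])
  moreover have "b \<noteq> 0"
    using assms b unfolding orthonormal_basis_def by (metis inner_zero_left zero_neq_one)
  ultimately show "a \<in> ?E" using b by auto
qed

lemma psd_spectral:
  assumes "psd M"
  obtains B c where "orthonormal_basis B" "M = spectral_matrix B c" "\<And>b. b \<in> B \<Longrightarrow> 0 \<le> c b"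
proof -
  obtain B c where B: "orthonormal_basis B" and M: "M = spectral_matrix B c"
    using spectral_theorem assms by (metis psd_def)
  have "0 \<le> c b" if "b \<in> B" for b
  proof -
    have "b \<bullet> (M *v b) = c b"
      using B that by (simp add: M spectral_matrix_eigenvector orthonormal_basis_def)
    then show ?thesis using assms by (metis psd_def)
  qed
  with B M show thesis by (rule that)
qed

lemma le_largest_eigenvalue:
  assumes "orthonormal_basis B" "b \<in> B"
  shows "c b \<le> largest_eigenvalue (spectral_matrix B c)"
  unfolding largest_eigenvalue_def spectral_matrix_eigenvalues[OF assms(1)]
  using assms by (simp add: orthonormal_basis_def)

lemma largest_eigenvalue_nonneg:
  assumes "psd M"
  shows "0 \<le> largest_eigenvalue M"
proof -
  obtain B c where B: "orthonormal_basis B" "M = spectral_matrix B c" "\<And>b. b \<in> B \<Longrightarrow> 0 \<le> c b"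
    using psd_spectral[OF assms] by blast
  moreover have "B \<noteq> {}" using B(1) by (auto simp: orthonormal_basis_def)
  ultimately show ?thesis by (meson all_not_in_conv le_largest_eigenvalue order_trans)
qed

lemma orthonormal_basis_norm:
  assumes "orthonormal_basis B"
  shows "(norm v)\<^sup>2 = (\<Sum>b\<in>B. (b \<bullet> v)\<^sup>2)"
proof -
  have "(norm v)\<^sup>2 = v \<bullet> (\<Sum>b\<in>B. (b \<bullet> v) *\<^sub>R b)"
    by (simp add: orthonormal_expand[OF assms] power2_norm_eq_inner)
  then show ?thesis by (simp add: inner_sum_right inner_commute power2_eq_square)
qed

text \<open>In the eigenbasis the two sides weight \<open>(b \<bullet> v)\<^sup>2\<close> by the
  square of \<open>c b\<close> and by \<open>c b\<close> times the largest eigenvalue. This turns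
  the norm of an image under \<open>M\<close> into the seminorm \<open>wnorm M\<close>.\<close>

lemma norm_mult_le_largest_eigenvalue:
  assumes "psd M"
  shows "(norm (M *v v))\<^sup>2 \<le> largest_eigenvalue M * (v \<bullet> (M *v v))"
proof -
  obtain B c where B: "orthonormal_basis B" and M: "M = spectral_matrix B c"
    and c: "\<And>b. b \<in> B \<Longrightarrow> 0 \<le> c b"
    using psd_spectral[OF assms] by blast
  have "(norm (M *v v))\<^sup>2 = (\<Sum>b\<in>B. c b * (c b * (b \<bullet> v)\<^sup>2))"
    unfolding orthonormal_basis_norm[OF B] by (intro sum.cong refl)
      (simp add: M inner_spectral_matrix[OF B] power2_eq_square)
  also have "\<dots> \<le> (\<Sum>b\<in>B. largest_eigenvalue M * (c b * (b \<bullet> v)\<^sup>2))"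
    using c le_largest_eigenvalue[OF B, of _ c] by (intro sum_mono mult_right_mono) (auto simp: M)
  also have "\<dots> = largest_eigenvalue M * (v \<bullet> (M *v v))"
    by (simp add: M spectral_matrix_form sum_distrib_left)
  finally show ?thesis .
qed

section \<open>Square roots and pseudoinverses\<close>

text \<open>Compare on an eigenbasis of \<open>S\<close>. If
  \<open>S *v b = c b *\<^sub>R b\<close>, then \<open>T\<close> maps
  \<open>w = T *v b - c b *\<^sub>R b\<close> to \<open>- c b *\<^sub>R w\<close>, which positive
  semidefiniteness forbids for \<open>c b > 0\<close> unless \<open>w = 0\<close>. For
  \<open>c b = 0\<close> the vector \<open>T *v b\<close> has norm zero.\<close>

lemma psd_sqrt_unique:
  assumes S: "psd S" and T: "psd T" and eq: "S ** S = T ** T"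
  shows "S = T"
proof -
  obtain B c where B: "orthonormal_basis B" and Sc: "S = spectral_matrix B c"
    and c: "\<And>b. b \<in> B \<Longrightarrow> 0 \<le> c b"
    using psd_spectral[OF S] by blast
  have "S *v b = T *v b" if "b \<in> B" for b
  proof -
    have Sb: "S *v b = c b *\<^sub>R b"
      using B that by (simp add: Sc spectral_matrix_eigenvector)
    have TT: "T *v (T *v b) = (c b)\<^sup>2 *\<^sub>R b"
      by (metis Sb eq matrix_vector_mul_assoc matrix_vector_mult_scaleR power2_eq_square
          scaleR_scaleR)
    define w where "w = T *v b - c b *\<^sub>R b"
    have Tw: "T *v w = - c b *\<^sub>R w"
      by (simp add: w_def matrix_vector_mult_diff_distrib matrix_vector_mult_scaleR TT
          power2_eq_square algebra_simps)
    have "w = 0"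
    proof (cases "c b = 0")
      case True
      have "(T *v b) \<bullet> (T *v b) = b \<bullet> (T *v (T *v b))"
        using T by (simp add: psd_def symmetric_inner)
      then show ?thesis using True TT by (simp add: w_def)
    next
      case False
      have "0 \<le> w \<bullet> (T *v w)" using T by (simp add: psd_def)
      then have "c b * (w \<bullet> w) \<le> 0" by (simp add: Tw)
      then have "w \<bullet> w \<le> 0" using False c[OF that] by (simp add: mult_le_0_iff)
      then show ?thesis by (metis antisym inner_eq_zero_iff inner_ge_zero)
    qed
    then show ?thesis by (simp add: Sb w_def)
  qed
  then have "S *v v = T *v v" for v
    using linear_eq_on_span[OF matrix_vector_mul_linear matrix_vector_mul_linear, of B S T v] B
    by (auto simp: orthonormal_basis_def)
  then show ?thesis by (simp add: matrix_eq)
qed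

lemma psd_sqrt:
  assumes "psd M"
  shows "psd (psd_sqrt M)" "psd_sqrt M ** psd_sqrt M = M"
proof -
  obtain B c where B: "orthonormal_basis B" and M: "M = spectral_matrix B c"
    and c: "\<And>b. b \<in> B \<Longrightarrow> 0 \<le> c b"
    using psd_spectral[OF assms] by blast
  define S where "S = spectral_matrix B (\<lambda>b. sqrt (c b))"
  have "spectral_matrix B (\<lambda>b. sqrt (c b) * sqrt (c b)) = spectral_matrix B c"
    by (simp add: matrix_eq spectral_matrix_apply c)
  then have "psd S \<and> S ** S = M"
    using c by (simp add: S_def spectral_matrix_psd spectral_matrix_mult[OF B] M)
  then have "\<exists>!S. psd S \<and> S ** S = M"
    using psd_sqrt_unique by metis
  from theI'[OF this, folded psd_sqrt_def]
  show "psd (psd_sqrt M)" "psd_sqrt M ** psd_sqrt M = M" by auto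
qed

text \<open>\<open>M ** B\<close> and \<open>M ** C\<close> are both the orthogonal projection onto
  the range of \<open>M\<close>; \<open>B ** M\<close> and \<open>C ** M\<close> both project onto
  the orthogonal complement of its kernel. Then
  \<open>B = B ** M ** B = C ** M ** C = C\<close>.\<close>

lemma penrose_unique:
  fixes M :: "real^'n^'m"
  assumes B: "M ** B ** M = M" "B ** M ** B = B"
      "transpose (M ** B) = M ** B" "transpose (B ** M) = B ** M"
    and C: "M ** C ** M = M" "C ** M ** C = C"
      "transpose (M ** C) = M ** C" "transpose (C ** M) = C ** M"
  shows "B = C"
proof -
  have "M ** B = transpose (M ** C ** (M ** B))"
    using B(3) C(1) by (metis matrix_mul_assoc)
  also have "\<dots> = M ** B ** (M ** C)" by (metis B(3) C(3) matrix_transpose_mul)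
  also have "\<dots> = M ** C" using B(1) by (metis matrix_mul_assoc)
  finally have l: "M ** B = M ** C" .
  have "B ** M = transpose (B ** M ** (C ** M))"
    using B(4) C(1) by (metis matrix_mul_assoc)
  also have "\<dots> = C ** M ** (B ** M)" by (metis B(4) C(4) matrix_transpose_mul)
  also have "\<dots> = C ** M" using B(1) by (metis matrix_mul_assoc)
  finally have r: "B ** M = C ** M" .
  have "B = B ** (M ** B)" using B(2) by (simp add: matrix_mul_assoc)
  also have "\<dots> = C ** M ** C" by (simp add: l r matrix_mul_assoc)
  finally show ?thesis using C(2) by simp
qed

lemma pinv_symmetric:
  fixes M :: "real^'n^'n"
  assumes "transpose M = M"
  shows "M ** pinv M ** M = M" "transpose (M ** pinv M) = M ** pinv M"
proof -
  obtain B c where B: "orthonormal_basis B" and M: "M = spectral_matrix B c"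
    using spectral_theorem assms by metis
  \<comment> \<open>Since \<open>inverse 0 = 0\<close>, this candidate inverts \<open>M\<close> on
    its range and vanishes on its kernel.\<close>
  let ?I = "spectral_matrix B (\<lambda>b. inverse (c b))"
  have [simp]: "a * inverse a * a = a" "inverse a * a * inverse a = inverse a" for a :: real
    by (cases "a = 0"; simp)+
  have "M ** ?I ** M = M \<and> ?I ** M ** ?I = ?I \<and>
    transpose (M ** ?I) = M ** ?I \<and> transpose (?I ** M) = ?I ** M"
    by (simp add: M spectral_matrix_mult[OF B] spectral_matrix_symmetric)
  then have "\<exists>!C. M ** C ** M = M \<and> C ** M ** C = C \<and>
    transpose (M ** C) = M ** C \<and> transpose (C ** M) = C ** M"
    by (intro ex1I[of _ ?I]) (auto intro: penrose_unique)
  from theI'[OF this, folded pinv_def]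
  show "M ** pinv M ** M = M" "transpose (M ** pinv M) = M ** pinv M" by auto
qed

section \<open>Agentwise structure\<close>

text \<open>Stacked vectors are regrouped by component: \<open>slice u a\<close> collects the \<open>a\<close>-th component of all
  blocks, so that \<open>kron P (mat 1)\<close> acts as \<open>P\<close> on every slice.\<close>

definition slice :: "real^('n::finite \<times> 'a::finite) \<Rightarrow> 'a \<Rightarrow> real^'n" where
  "slice u a = (\<chi> i. u $ (i, a))"

definition agent_sum :: "real^('n::finite \<times> 'a::finite) \<Rightarrow> real^'a" where
  "agent_sum u = (\<chi> a. \<Sum>i\<in>UNIV. u $ (i, a))"

lemma slice_nth [simp]: "slice u a $ i = u $ (i, a)"
  by (simp add: slice_def)

lemma agent_sum_nth: "agent_sum u $ a = vec 1 \<bullet> slice u a"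
  by (simp add: agent_sum_def inner_vec_def)

lemma slice_eq_iff: "u = v \<longleftrightarrow> (\<forall>a. slice u a = slice v a)"
  by (auto simp: vec_eq_iff)

lemma slice_linear:
  "slice (u + v) a = slice u a + slice v a" "slice (u - v) a = slice u a - slice v a"
  "slice (c *\<^sub>R u) a = c *\<^sub>R slice u a" "slice 0 a = 0"
  by (simp_all add: vec_eq_iff)

lemma linear_agent_sum: "linear agent_sum"
  by (rule linearI) (simp_all add: vec_eq_iff agent_sum_def sum.distrib sum_distrib_left)

lemma inner_prod_index:
  fixes u v :: "real^('n::finite \<times> 'a::finite)"
  shows "u \<bullet> v = (\<Sum>i\<in>UNIV. \<Sum>a\<in>UNIV. u $ (i, a) * v $ (i, a))"
  by (simp add: inner_vec_def sum.cartesian_product)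

lemma inner_slice:
  fixes u v :: "real^('n::finite \<times> 'a::finite)"
  shows "u \<bullet> v = (\<Sum>a\<in>UNIV. slice u a \<bullet> slice v a)"
  unfolding inner_prod_index by (subst sum.swap) (simp add: inner_vec_def)

lemma slice_kron:
  fixes P :: "real^'n^'n" and u :: "real^('n \<times> 'a::finite)"
  shows "slice (kron P (mat 1) *v u) a = P *v slice u a"
proof -
  have "(kron P (mat 1) *v u) $ (i, a) = (P *v slice u a) $ i" for i
  proof -
    have "(kron P (mat 1) *v u) $ (i, a)
        = (\<Sum>(j, b)\<in>UNIV \<times> UNIV. if b = a then P $ i $ j * u $ (j, b) else 0)"
      by (auto simp: matrix_vector_mult_def kron_def mat_def intro!: sum.cong)
    also have "\<dots> = (\<Sum>j\<in>UNIV. \<Sum>b\<in>UNIV. if b = a then P $ i $ j * u $ (j, b) else 0)"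
      by (rule sum.cartesian_product[symmetric])
    finally show ?thesis by (simp add: matrix_vector_mult_def)
  qed
  then show ?thesis by (simp add: vec_eq_iff)
qed

lemma kron_inner:
  fixes P :: "real^'n^'n" and u :: "real^('n \<times> 'a::finite)"
  shows "u \<bullet> (kron P (mat 1) *v v) = (\<Sum>a\<in>UNIV. slice u a \<bullet> (P *v slice v a))"
  by (simp add: inner_slice slice_kron)

lemma psd_kron:
  fixes P :: "real^'n^'n"
  assumes "psd P"
  shows "psd (kron P (mat 1) :: real^('n \<times> 'a::finite)^('n \<times> 'a))"
proof -
  have "transpose (kron P (mat 1)) = (kron P (mat 1) :: real^('n \<times> 'a)^('n \<times> 'a))"
    using assms by (intro matrix_symmetricI)
      (simp add: psd_def inner_slice slice_kron symmetric_inner)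
  then show ?thesis
    using assms by (simp add: psd_def kron_inner sum_nonneg)
qed

lemma kron_add_scaleR: "kron (P + c *\<^sub>R Q) M = kron P M + c *\<^sub>R kron Q M"
  by (simp add: kron_def vec_eq_iff algebra_simps)

lemma kron_diff: "kron (P - Q) M = kron P M - kron Q M"
  by (simp add: kron_def vec_eq_iff algebra_simps)

lemma agent_sum_kron_eq_0:
  fixes P :: "real^'n^'n" and u :: "real^('n \<times> 'a::finite)"
  assumes "transpose P = P" "vec 1 \<in> null_space P"
  shows "agent_sum (kron P (mat 1) *v u) = 0"
proof -
  have "vec 1 \<bullet> (P *v v) = 0" for v
    using symmetric_inner[OF assms(1), of "vec 1" v] assms(2) by (simp add: null_space_def)
  then show ?thesis by (simp add: vec_eq_iff agent_sum_nth slice_kron)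
qed

text \<open>The origin of the constant in the final bound: in each slice, Cauchy-Schwarz against the
  all-ones vector costs a factor \<open>CARD('n)\<close>, and passing from the norm of
  \<open>P *v slice u a\<close> to the quadratic form costs the largest eigenvalue.\<close>

lemma norm_agent_sum_kron_le:
  fixes P :: "real^'n^'n" and u :: "real^('n \<times> 'a::finite)"
  assumes "psd P"
  shows "norm (agent_sum (kron P (mat 1) *v u))
    \<le> sqrt (real CARD('n) * largest_eigenvalue P) * wnorm (kron P (mat 1)) u"
proof -
  have "(norm (agent_sum (kron P (mat 1) *v u)))\<^sup>2
      = (\<Sum>a\<in>UNIV. (vec 1 \<bullet> (P *v slice u a))\<^sup>2)"
    unfolding power2_norm_eq_inner inner_vec_def[of "agent_sum (kron P (mat 1) *v u)"]
    by (simp add: agent_sum_nth slice_kron power2_eq_square)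
  also have "\<dots> \<le> (\<Sum>a\<in>UNIV. real CARD('n) * (largest_eigenvalue P * (slice u a \<bullet> (P *v slice u a))))"
  proof (rule sum_mono)
    fix a
    have "(vec 1 \<bullet> (P *v slice u a))\<^sup>2
        \<le> (vec 1 \<bullet> (vec 1 :: real^'n)) * ((P *v slice u a) \<bullet> (P *v slice u a))"
      by (rule Cauchy_Schwarz_ineq)
    also have "vec 1 \<bullet> (vec 1 :: real^'n) = real CARD('n)"
      by (simp add: inner_vec_def)
    finally show "(vec 1 \<bullet> (P *v slice u a))\<^sup>2
        \<le> real CARD('n) * (largest_eigenvalue P * (slice u a \<bullet> (P *v slice u a)))"
      using norm_mult_le_largest_eigenvalue[OF assms, of "slice u a"]
      by (simp add: power2_norm_eq_inner) (meson mult_left_mono of_nat_0_le_iff order_trans)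
  qed
  also have "\<dots> = real CARD('n) * largest_eigenvalue P * (u \<bullet> (kron P (mat 1) *v u))"
    by (simp add: kron_inner sum_distrib_left mult.assoc)
  finally show ?thesis
    unfolding wnorm_def by (metis real_le_rsqrt real_sqrt_mult)
qed

section \<open>Square roots, seminorms and consensus vectors\<close>

lemma psd_sqrt_symmetric: "psd M \<Longrightarrow> transpose (psd_sqrt M) = psd_sqrt M"
  using psd_sqrt(1) by (auto simp: psd_def)

lemma psd_sqrt_null:
  assumes "psd M"
  shows "psd_sqrt M *v u = 0 \<longleftrightarrow> M *v u = 0"
proof
  assume "M *v u = 0"
  then have "u \<bullet> (psd_sqrt M *v (psd_sqrt M *v u)) = 0"
    by (simp add: matrix_vector_mul_assoc psd_sqrt(2)[OF assms])
  then have "(psd_sqrt M *v u) \<bullet> (psd_sqrt M *v u) = 0"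
    by (simp add: symmetric_inner[OF psd_sqrt_symmetric[OF assms]])
  then show "psd_sqrt M *v u = 0" by simp
qed (metis psd_sqrt(2)[OF assms] matrix_vector_mul_assoc matrix_vector_mult_0_right)

lemma wnorm_eq_norm_psd_sqrt:
  assumes "psd M"
  shows "wnorm M v = norm (psd_sqrt M *v v)"
proof -
  have "(psd_sqrt M *v v) \<bullet> (psd_sqrt M *v v) = v \<bullet> (M *v v)"
    by (simp add: symmetric_inner[OF psd_sqrt_symmetric[OF assms]] matrix_vector_mul_assoc
        psd_sqrt(2)[OF assms])
  then show ?thesis by (simp add: wnorm_def norm_eq_sqrt_inner)
qed

lemma wnorm_diff_triangle:
  assumes "psd M"
  shows "wnorm M (u - v) \<le> wnorm M u + wnorm M v"
  by (simp add: wnorm_eq_norm_psd_sqrt[OF assms] matrix_vector_mult_diff_distrib norm_triangle_ineq4)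

lemma psd_sqrt_kron_null:
  fixes P :: "real^'n^'n" and u :: "real^('n \<times> 'a::finite)"
  assumes "psd P"
  shows "psd_sqrt (kron P (mat 1)) *v u = 0 \<longleftrightarrow> (\<forall>a. slice u a \<in> null_space P)"
  unfolding psd_sqrt_null[OF psd_kron[OF assms]]
  by (simp add: slice_eq_iff slice_kron slice_linear null_space_def)

text \<open>The root has the same kernel as \<open>kron P (mat 1)\<close>, so by symmetry its range
  is orthogonal to consensus vectors. Component \<open>a\<close> of the agent sum is the inner
  product with the consensus vector \<open>e\<close> that has ones exactly in component
  \<open>a\<close> of every block.\<close>

lemma agent_sum_psd_sqrt_kron:
  fixes P :: "real^'n^'n" and u :: "real^('n \<times> 'a::finite)"
  assumes "psd P" "vec 1 \<in> null_space P"
  shows "agent_sum (psd_sqrt (kron P (mat 1)) *v u) = 0"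
proof -
  let ?R = "psd_sqrt (kron P (mat 1)) :: real^('n \<times> 'a)^('n \<times> 'a)"
  have "agent_sum (?R *v u) $ a = 0" for a
  proof -
    define e :: "real^('n \<times> 'a)" where "e = blocks (\<lambda>_. axis a 1)"
    have e: "slice e b = (if b = a then vec 1 else 0)" for b
      by (simp add: vec_eq_iff e_def blocks_def axis_def)
    have "?R *v e = 0"
      using assms by (simp add: psd_sqrt_kron_null e null_space_def)
    then have "e \<bullet> (?R *v u) = 0"
      by (metis assms(1) inner_zero_left psd_kron psd_sqrt_symmetric symmetric_inner)
    moreover have "e \<bullet> (?R *v u) = (\<Sum>b\<in>UNIV. if b = a then vec 1 \<bullet> slice (?R *v u) b else 0)"
      unfolding inner_slice by (rule sum.cong) (auto simp: e)
    ultimately show ?thesis by (simp add: agent_sum_nth)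
  qed
  then show ?thesis by (simp add: vec_eq_iff)
qed

text \<open>On the complement of the consensus subspace the square root is invertible, so only the
  average over the agents is lost.\<close>

lemma inner_psd_sqrt_pinv:
  fixes P :: "real^'n^'n" and u y :: "real^('n \<times> 'a::finite)"
  assumes "psd P" and null: "null_space P = span {vec 1}"
  defines "R \<equiv> psd_sqrt (kron P (mat 1))"
  shows "y \<bullet> (R *v (pinv R *v u)) = y \<bullet> u - agent_sum y \<bullet> agent_sum u / real CARD('n)"
proof -
  have sym: "transpose R = R"
    unfolding R_def by (rule psd_sqrt_symmetric[OF psd_kron[OF assms(1)]])
  have one: "vec 1 \<in> null_space P" by (simp add: null span_base)
  \<comment> \<open>The part of \<open>u\<close> lost by the projection \<open>R ** pinv R\<close>.
    It lies in the kernel of \<open>R\<close>, hence every slice is constant; since the retained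
    part has agent sum zero, that constant is the agent average of \<open>u\<close>.\<close>
  define e where "e = u - R *v (pinv R *v u)"
  \<comment> \<open>The Penrose equations give \<open>R ** pinv R ** R = R\<close>; transposing
    moves the projection to the other side of \<open>R\<close>.\<close>
  have "R ** (R ** pinv R) = transpose (R ** pinv R ** R)"
    by (simp only: matrix_transpose_mul[of "R ** pinv R"] pinv_symmetric(2)[OF sym] sym)
  also have "\<dots> = R" by (simp add: pinv_symmetric[OF sym] sym)
  finally have "R *v e = 0"
    by (simp add: e_def matrix_vector_mult_diff_distrib matrix_vector_mul_assoc matrix_mul_assoc)
  then have "\<forall>a. \<exists>t. slice e a = t *\<^sub>R vec 1"
    using psd_sqrt_kron_null[OF assms(1), of e] by (auto simp: R_def null span_singleton)
  then obtain t where t: "\<And>a. slice e a = t a *\<^sub>R vec 1" by metis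
  have "agent_sum e = agent_sum u"
    using agent_sum_psd_sqrt_kron[OF assms(1) one, of "pinv R *v u"]
    by (simp add: e_def linear_diff[OF linear_agent_sum] R_def)
  then have "t a * real CARD('n) = agent_sum u $ a" for a
    using agent_sum_nth[of e a] by (simp add: t inner_vec_def)
  then have "t a = agent_sum u $ a / real CARD('n)" for a
    by (metis nonzero_eq_divide_eq of_nat_0_eq_iff zero_less_card_finite less_numeral_extra(3))
  moreover have "y \<bullet> e = (\<Sum>a\<in>UNIV. t a * agent_sum y $ a)"
    unfolding inner_slice[of y e] by (simp add: t agent_sum_nth inner_commute)
  ultimately have "y \<bullet> e = agent_sum y \<bullet> agent_sum u / real CARD('n)"
    by (simp add: inner_vec_def[of "agent_sum y"] sum_divide_distrib mult.commute)
  then show ?thesis by (simp add: e_def inner_diff_right)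
qed

section \<open>Diagonal weights\<close>

lemma kron_diagonal_apply:
  fixes P :: "real^'n^'n" and u :: "real^('n \<times> 'a::finite)"
  assumes "diagonal P"
  shows "(kron P (mat 1) *v u) $ (i, a) = P $ i $ i * u $ (i, a)"
proof -
  have "(kron P (mat 1) *v u) $ (i, a) = (\<Sum>j\<in>UNIV. P $ i $ j * u $ (j, a))"
    using arg_cong[OF slice_kron[of P u a], of "\<lambda>v. v $ i"]
    by (simp add: matrix_vector_mult_def[of P])
  also have "\<dots> = (\<Sum>j\<in>UNIV. if j = i then P $ i $ i * u $ (i, a) else 0)"
    using assms by (intro sum.cong) (auto simp: diagonal_def)
  finally show ?thesis by simp
qed

lemma matrix_inv_diagonal_kron:
  fixes P :: "real^'n^'n" and w :: "real^('n \<times> 'a::finite)"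
  assumes "diagonal P" "\<And>i. P $ i $ i \<noteq> 0"
  shows "(matrix_inv (kron P (mat 1)) *v w) $ (i, a) = w $ (i, a) / P $ i $ i"
proof -
  \<comment> \<open>\<open>matrix_inv\<close> is defined by choice, so an explicit two-sided inverse
    is exhibited before anything is read off from it.\<close>
  define Q :: "real^'n^'n" where "Q = (\<chi> i j. if i = j then 1 / P $ i $ i else 0)"
  have Q: "diagonal Q" "Q $ i $ i = 1 / P $ i $ i" for i
    by (auto simp: Q_def diagonal_def)
  have "kron P (mat 1) ** kron Q (mat 1) = (mat 1 :: real^('n \<times> 'a)^('n \<times> 'a))"
    "kron Q (mat 1) ** kron P (mat 1) = (mat 1 :: real^('n \<times> 'a)^('n \<times> 'a))"
    by (auto simp: matrix_eq vec_eq_iff kron_diagonal_apply Q assms simp flip: matrix_vector_mul_assoc)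
  then have "\<exists>B. kron P (mat 1) ** B = (mat 1 :: real^('n \<times> 'a)^('n \<times> 'a)) \<and> B ** kron P (mat 1) = mat 1"
    by blast
  from someI_ex[OF this]
  have "kron P (mat 1) ** matrix_inv (kron P (mat 1)) = (mat 1 :: real^('n \<times> 'a)^('n \<times> 'a))"
    by (simp add: matrix_inv_def)
  then have "kron P (mat 1) *v (matrix_inv (kron P (mat 1)) *v w) = w"
    by (simp add: matrix_vector_mul_assoc)
  then have "P $ i $ i * (matrix_inv (kron P (mat 1)) *v w) $ (i, a) = w $ (i, a)"
    by (metis assms(1) kron_diagonal_apply)
  then show ?thesis using assms(2)[of i] by (simp add: field_simps)
qed

section \<open>Stacked vectors, the block seminorm and the cone\<close>

lemma inner_stack: "stack u v \<bullet> stack u' v' = u \<bullet> u' + v \<bullet> v'"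
  unfolding inner_vec_def by (simp add: stack_def sum.Plus flip: UNIV_Plus_UNIV)

lemma stack_diff: "stack u v - stack u' v' = stack (u - u') (v - v')"
  by (auto simp: vec_eq_iff stack_def split: sum.split)

lemma block_diag_mult_stack: "block_diag M M' *v stack u v = stack (M *v u) (M' *v v)"
proof -
  have "(block_diag M M' *v stack u v) $ q = stack (M *v u) (M' *v v) $ q" for q
    by (cases q) (simp_all add: matrix_vector_mult_def block_diag_def stack_def sum.Plus
        flip: UNIV_Plus_UNIV)
  then show ?thesis by (simp add: vec_eq_iff)
qed

lemma wnorm_block_diag:
  "(wnorm (block_diag M (c *\<^sub>R mat 1)) (stack u v))\<^sup>2 = u \<bullet> (M *v u) + c * (v \<bullet> v)"
  if "psd M" "0 \<le> c"
  using that by (simp add: wnorm_def block_diag_mult_stack inner_stack psd_def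
      scaleR_matrix_vector_assoc[symmetric])

lemma wnorm_block_diag_nonneg:
  assumes "psd M" "0 \<le> c"
  shows "0 \<le> wnorm (block_diag M (c *\<^sub>R mat 1)) (stack u v)"
  using assms by (simp add: wnorm_def block_diag_mult_stack inner_stack psd_def
      scaleR_matrix_vector_assoc[symmetric])

lemma inner_blocks: "blocks (\<lambda>_. v) \<bullet> u = v \<bullet> agent_sum u"
  unfolding inner_prod_index by (subst sum.swap)
    (simp add: blocks_def agent_sum_def inner_vec_def[of v] sum_distrib_left)

lemma slice_blocks_const: "slice (blocks (\<lambda>_. v)) a = (v $ a) *\<^sub>R vec 1"
  by (simp add: vec_eq_iff blocks_def)

lemma agent_sum_gtilde: "agent_sum (gtilde g h x) = stack (tot g x) (tot h x)"
  by (auto simp: vec_eq_iff agent_sum_def gtilde_def blocks_def stack_def tot_def split: sum.split)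

text \<open>\<open>Kset\<close> constrains each coordinate separately, so clipping is at least as
  close as any other point of \<open>Kset\<close> in every coordinate. Uniqueness of projection onto
  a closed convex set identifies the result.\<close>

lemma closest_point_Kset:
  "closest_point Kset w $ (i, s) = (case s of Inl j \<Rightarrow> max 0 (w $ (i, s)) | Inr l \<Rightarrow> w $ (i, s))"
proof -
  define p :: "real^('a \<times> ('b + 'c))" where
    "p = (\<chi> q. case snd q of Inl j \<Rightarrow> max 0 (w $ q) | Inr l \<Rightarrow> w $ q)"
  have K: "Kset = (\<Inter>i. \<Inter>j. {y :: real^('a \<times> ('b + 'c)). y $ (i, Inl j) \<ge> 0})"
    by (auto simp: Kset_def)
  have "convex (Kset :: (real^('a \<times> ('b + 'c))) set)"
    unfolding K by (intro convex_INT) (auto simp: convex_def)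
  moreover have "closed (Kset :: (real^('a \<times> ('b + 'c))) set)"
    unfolding K by (intro closed_INT ballI closed_halfspace_component_ge_cart)
  moreover have "p \<in> Kset" by (simp add: Kset_def p_def)
  moreover have "dist w p \<le> dist w y" if "y \<in> Kset" for y
    unfolding dist_norm
  proof (rule norm_le_componentwise_cart)
    fix q :: "'a \<times> ('b + 'c)"
    have y: "0 \<le> y $ (i, Inl j)" for i j using that by (simp add: Kset_def)
    obtain i s where q: "q = (i, s)" by (cases q)
    show "norm ((w - p) $ q) \<le> norm ((w - y) $ q)"
    proof (cases s)
      case (Inl j)
      then show ?thesis using y[of i j] by (simp add: p_def q)
    qed (simp add: p_def q)
  qed
  ultimately have "closest_point Kset w = p" by (intro closest_point_unique[symmetric] ballI)
  then show ?thesis by (simp add: p_def)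
qed

section \<open>The primal step\<close>

lemma affine_map_on_sum:
  assumes "affine_map_on S h" "(\<Sum>l\<in>I. c l) = 1"
    and "\<And>l. l \<in> I \<Longrightarrow> a l \<in> S" "(\<Sum>l\<in>I. c l *\<^sub>R a l) \<in> S"
  shows "h (\<Sum>l\<in>I. c l *\<^sub>R a l) = (\<Sum>l\<in>I. c l *\<^sub>R h (a l))"
proof -
  obtain L b where L: "linear L" "\<And>v. v \<in> S \<Longrightarrow> h v = L v + b"
    using assms(1) by (auto simp: affine_map_on_def)
  have "(\<Sum>l\<in>I. c l *\<^sub>R h (a l)) = (\<Sum>l\<in>I. c l *\<^sub>R L (a l)) + (\<Sum>l\<in>I. c l) *\<^sub>R b"
    by (simp add: L(2) assms(3) scaleR_add_right sum.distrib scaleR_left.sum)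
  then show ?thesis
    by (simp add: L assms linear_sum[OF L(1)] linear_scale[OF L(1)])
qed

lemma affine_map_on_segment:
  assumes "affine_map_on S h" "convex S" "a \<in> S" "b \<in> S" "0 \<le> t" "t \<le> 1"
  shows "h ((1 - t) *\<^sub>R a + t *\<^sub>R b) = (1 - t) *\<^sub>R h a + t *\<^sub>R h b"
proof -
  have "(1 - t) *\<^sub>R a + t *\<^sub>R b \<in> S"
    using assms by (intro convexD) auto
  then show ?thesis
    \<comment> \<open>The type \<open>bool\<close> serves as a two-element index set, with
      \<open>True\<close> standing for the endpoint \<open>a\<close>.\<close>
    using affine_map_on_sum[OF assms(1), where I = UNIV and c = "\<lambda>s. if s then 1 - t else t"
        and a = "\<lambda>s. if s then a else b"] assms by (simp add: UNIV_bool add.commute)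
qed

text \<open>A quadratic upper model of the squared positive part. That square is nondecreasing, so
  an upper bound on the argument suffices, which is what convexity of the inequality constraints
  provides.\<close>

lemma max_0_square_le:
  fixes s s' d :: real
  assumes "s' \<le> s + d"
  shows "(max 0 s')\<^sup>2 \<le> (max 0 s)\<^sup>2 + 2 * (max 0 s * d) + d\<^sup>2"
proof -
  have "(max 0 s')\<^sup>2 \<le> (max 0 s + d)\<^sup>2"
  proof (cases "s' \<le> 0")
    case False
    then show ?thesis using assms by (intro power_mono) auto
  qed simp
  then show ?thesis by (simp add: power2_eq_square algebra_simps)
qed

lemma wnorm_matrix_inv_diagonal:
  fixes P :: "real^'n^'n" and p :: "real^('n \<times> 'a::finite)"
  assumes "diagonal P" "\<And>i. 0 < P $ i $ i"
  shows "(wnorm (matrix_inv (kron P (mat 1))) p)\<^sup>2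
    = (\<Sum>i\<in>UNIV. \<Sum>a\<in>UNIV. (p $ (i, a))\<^sup>2 / P $ i $ i)"
proof -
  have nz: "P $ i $ i \<noteq> 0" for i using assms(2)[of i] by simp
  have "p \<bullet> (matrix_inv (kron P (mat 1)) *v p)
      = (\<Sum>i\<in>UNIV. \<Sum>a\<in>UNIV. (p $ (i, a))\<^sup>2 / P $ i $ i)"
    by (simp add: inner_prod_index matrix_inv_diagonal_kron[OF assms(1) nz] power2_eq_square)
  moreover have "0 \<le> (\<Sum>i\<in>UNIV. \<Sum>a\<in>UNIV. (p $ (i, a))\<^sup>2 / P $ i $ i)"
    using assms(2) by (intro sum_nonneg divide_nonneg_pos) auto
  ultimately show ?thesis by (simp add: wnorm_def)
qed

text \<open>Dividing by positive numbers preserves signs, so the scaling commutes with clipping.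
  This matches the dual update with the vector penalised in the primal update.\<close>

lemma closest_point_Kset_scaled:
  fixes P :: "real^'n^'n" and w :: "real^('n \<times> ('m::finite + 'p::finite))"
  assumes "diagonal P" "\<And>i. 0 < P $ i $ i"
  shows "closest_point Kset (matrix_inv (kron P (mat 1)) *v w) $ (i, s)
    = closest_point Kset w $ (i, s) / P $ i $ i"
proof -
  have nz: "P $ i $ i \<noteq> 0" for i using assms(2)[of i] by simp
  show ?thesis
    using assms(2)[of i]
    by (auto simp: closest_point_Kset matrix_inv_diagonal_kron[OF assms(1) nz] max_def
        zero_le_divide_iff split: sum.split)
qed

text \<open>The penalty is differentiable with gradient \<open>y\<close>, the next dual iterate; minimality along
  segments then turns the penalised problem into the linearised one.\<close>

lemma primal_step:
  fixes X :: "'n::finite \<Rightarrow> (real^'d) set"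
    and g :: "'n \<Rightarrow> real^'d \<Rightarrow> real^'m" and h :: "'n \<Rightarrow> real^'d \<Rightarrow> real^'p"
    and P :: "real^'n^'n"
  assumes convex_X: "\<And>i. convex (X i)"
    and convex_f: "\<And>i. convex_on (X i) (f i)"
    and convex_g: "\<And>i j. convex_on (X i) (\<lambda>v. g i v $ j)"
    and affine_h: "\<And>i. affine_map_on (X i) (h i)"
    and P: "diagonal P" "\<And>i. 0 < P $ i $ i"
    and min: "is_arg_min (\<lambda>u. tot f u + (1/2) * (wnorm (matrix_inv (kron P (mat 1)))
        (closest_point Kset (v + gtilde g h u)))\<^sup>2) (\<lambda>u. u \<in> prod_set X) x"
    and u: "u \<in> prod_set X"
  defines "y \<equiv> closest_point Kset (matrix_inv (kron P (mat 1)) *v (v + gtilde g h x))"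
  shows "tot f x + y \<bullet> gtilde g h x \<le> tot f u + y \<bullet> gtilde g h u"
proof -
  define F where "F w = (wnorm (matrix_inv (kron P (mat 1))) (closest_point Kset w))\<^sup>2"
    for w :: "real^('n \<times> ('m + 'p))"
  have F: "F w = (\<Sum>i\<in>UNIV. \<Sum>s\<in>UNIV. (closest_point Kset w $ (i, s))\<^sup>2 / P $ i $ i)" for w
    unfolding F_def by (rule wnorm_matrix_inv_diagonal[OF P])
  define \<Delta> where "\<Delta> = gtilde g h u - gtilde g h x"
  define w where "w = v + gtilde g h x"
  define C where "C = (\<Sum>i\<in>UNIV. \<Sum>s\<in>UNIV. (\<Delta> $ (i, s))\<^sup>2 / P $ i $ i)"
  have x: "x \<in> prod_set X" using min by (simp add: is_arg_min_def)
  \<comment> \<open>Minimality of \<open>x\<close> is tested at the point at fraction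
    \<open>t\<close> of the segment to \<open>u\<close>. Bounding every term by a quadratic in
    \<open>t\<close> leaves no constant term, so the linear coefficient is nonnegative.\<close>
  have "0 \<le> t * (tot f u - tot f x + y \<bullet> \<Delta>) + t\<^sup>2 * (C / 2)" if t: "0 < t" "t \<le> 1" for t
  proof -
    define ut where "ut = (1 - t) *\<^sub>R x + t *\<^sub>R u"
    define w' where "w' = v + gtilde g h ut"
    have ut: "ut $ i = (1 - t) *\<^sub>R x $ i + t *\<^sub>R u $ i" for i by (simp add: ut_def)
    have xi: "x $ i \<in> X i" "u $ i \<in> X i" for i using x u by (auto simp: prod_set_def)
    have "ut \<in> prod_set X"
      using xi t convex_X by (auto simp: prod_set_def ut intro!: convexD)
    then have opt: "tot f x + (1/2) * F w \<le> tot f ut + (1/2) * F w'"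
      using min by (simp add: is_arg_min_def F_def w_def w'_def not_less)
    have "tot f ut \<le> (\<Sum>i\<in>UNIV. (1 - t) * f i (x $ i) + t * f i (u $ i))"
      unfolding tot_def ut using xi t by (intro sum_mono convex_onD[OF convex_f]) auto
    then have ft: "tot f ut \<le> (1 - t) * tot f x + t * tot f u"
      by (simp add: tot_def sum.distrib sum_distrib_left)
    have comp: "(closest_point Kset w' $ (i, s))\<^sup>2 \<le> (closest_point Kset w $ (i, s))\<^sup>2
        + 2 * (closest_point Kset w $ (i, s) * (t * \<Delta> $ (i, s))) + (t * \<Delta> $ (i, s))\<^sup>2" for i s
    proof (cases s)
      case (Inl j)
      have "g i (ut $ i) $ j \<le> (1 - t) * g i (x $ i) $ j + t * g i (u $ i) $ j"
        unfolding ut using xi t by (intro convex_onD[OF convex_g]) auto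
      then have "w' $ (i, s) \<le> w $ (i, s) + t * \<Delta> $ (i, s)"
        by (simp add: Inl w'_def w_def \<Delta>_def gtilde_def blocks_def stack_def algebra_simps)
      from max_0_square_le[OF this] show ?thesis
        by (simp add: closest_point_Kset Inl)
    next
      \<comment> \<open>These coordinates are not clipped and their square is not monotone, so an
        equality is required here; affinity of \<open>h i\<close> supplies it.\<close>
      case (Inr l)
      have "h i (ut $ i) = (1 - t) *\<^sub>R h i (x $ i) + t *\<^sub>R h i (u $ i)"
        unfolding ut using xi t by (intro affine_map_on_segment[OF affine_h convex_X]) auto
      then have "h i (ut $ i) $ l = (1 - t) * h i (x $ i) $ l + t * h i (u $ i) $ l" by simp
      then have "w' $ (i, s) = w $ (i, s) + t * \<Delta> $ (i, s)"
        by (simp add: Inr w'_def w_def \<Delta>_def gtilde_def blocks_def stack_def algebra_simps)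
      then show ?thesis
        by (simp add: closest_point_Kset Inr power2_eq_square algebra_simps)
    qed
    have "F w' \<le> (\<Sum>i\<in>UNIV. \<Sum>s\<in>UNIV. ((closest_point Kset w $ (i, s))\<^sup>2
        + 2 * (closest_point Kset w $ (i, s) * (t * \<Delta> $ (i, s))) + (t * \<Delta> $ (i, s))\<^sup>2) / P $ i $ i)"
      unfolding F using P(2) comp by (intro sum_mono divide_right_mono) (auto intro: less_imp_le)
    also have "\<dots> = F w + 2 * t * (y \<bullet> \<Delta>) + t\<^sup>2 * C"
      unfolding F C_def y_def w_def[symmetric] inner_prod_index closest_point_Kset_scaled[OF P]
      by (simp add: sum.distrib sum_distrib_left add_divide_distrib power_mult_distrib mult_ac)
    finally have "F w' \<le> F w + 2 * t * (y \<bullet> \<Delta>) + t\<^sup>2 * C" .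
    with opt ft show ?thesis by (simp add: algebra_simps)
  qed
  then have "0 \<le> tot f u - tot f x + y \<bullet> \<Delta>" by (rule linear_coeff_nonneg)
  then show ?thesis by (simp add: \<Delta>_def inner_diff_right)
qed

text \<open>The dual value at the multipliers is a lower bound for the Lagrangian on
  \<open>prod_set X\<close>, and the zero duality gap equates it with
  \<open>tot f xs\<close>.\<close>

lemma primal_dual_optimal_saddle:
  assumes "primal_dual_optimal X f g h xs \<mu> \<nu>" "u \<in> prod_set X"
  shows "tot f xs \<le> tot f u + blocks (\<lambda>_. stack \<mu> \<nu>) \<bullet> gtilde g h u"
proof -
  have "ereal (tot f xs) \<le> ereal (lagrangian f g h \<mu> \<nu> u)"
    using assms unfolding primal_dual_optimal_def dual_fun_def by (metis INF_lower)
  then show ?thesis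
    by (simp add: lagrangian_def inner_blocks agent_sum_gtilde inner_stack)
qed

section \<open>Constraints at running averages\<close>

lemma running_avg_nth: "running_avg x k $ i = (\<Sum>l=1..k. (1 / real k) *\<^sub>R (x l $ i))"
  by (simp add: running_avg_def scaleR_sum_right)

lemma convex_on_running_avg:
  fixes x :: "nat \<Rightarrow> real^'d^'n"
  assumes "\<And>i. convex_on (X i) (\<lambda>v. g i v $ j)" "\<And>l. 1 \<le> l \<Longrightarrow> x l \<in> prod_set X" "1 \<le> k"
  shows "tot g (running_avg x k) $ j \<le> (\<Sum>l=1..k. tot g (x l) $ j) / real k"
proof -
  have "tot g (running_avg x k) $ j \<le> (\<Sum>i\<in>UNIV. \<Sum>l=1..k. (1 / real k) * (g i (x l $ i) $ j))"
    unfolding tot_def sum_component running_avg_nth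
  proof (rule sum_mono)
    fix i
    show "g i (\<Sum>l=1..k. (1 / real k) *\<^sub>R x l $ i) $ j \<le> (\<Sum>l=1..k. (1 / real k) * (g i (x l $ i) $ j))"
      using assms by (intro convex_on_sum[OF _ _ assms(1)]) (auto simp: prod_set_def)
  qed
  also have "\<dots> = (\<Sum>l=1..k. tot g (x l) $ j) / real k"
    by (subst sum.swap) (simp add: tot_def sum_divide_distrib)
  finally show ?thesis .
qed

lemma affine_running_avg:
  fixes x :: "nat \<Rightarrow> real^'d^'n" and h :: "'n \<Rightarrow> real^'d \<Rightarrow> real^'p"
  assumes "\<And>i. affine_map_on (X i) (h i)" "\<And>i. convex (X i)"
    and "\<And>l. 1 \<le> l \<Longrightarrow> x l \<in> prod_set X" "1 \<le> k"
  shows "tot h (running_avg x k) = (1 / real k) *\<^sub>R (\<Sum>l=1..k. tot h (x l))"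
proof -
  have "h i (running_avg x k $ i) = (\<Sum>l=1..k. (1 / real k) *\<^sub>R h i (x l $ i))" for i
    unfolding running_avg_nth using assms
    by (intro affine_map_on_sum[OF assms(1)] convex_sum) (auto simp: prod_set_def)
  then have "tot h (running_avg x k) = (\<Sum>i\<in>UNIV. \<Sum>l=1..k. (1 / real k) *\<^sub>R h i (x l $ i))"
    by (simp add: tot_def)
  also have "\<dots> = (\<Sum>l=1..k. \<Sum>i\<in>UNIV. (1 / real k) *\<^sub>R h i (x l $ i))"
    by (rule sum.swap)
  finally show ?thesis by (simp add: tot_def scaleR_sum_right)
qed

section \<open>The dual iterates\<close>

locale duca_run =
  fixes X :: "'n::finite \<Rightarrow> (real^'d) set"
    and f :: "'n \<Rightarrow> real^'d \<Rightarrow> real"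
    and g :: "'n \<Rightarrow> real^'d \<Rightarrow> real^'m"
    and h :: "'n \<Rightarrow> real^'d \<Rightarrow> real^'p"
    and PA PH PHt :: "real^'n^'n"
    and \<rho> :: real
    and xs :: "real^'d^'n" and \<mu>s :: "real^'m" and \<nu>s :: "real^'p"
    and x :: "nat \<Rightarrow> real^'d^'n"
    and y z :: "nat \<Rightarrow> real^('n \<times> ('m + 'p))"
  assumes convex_X: "convex (X i)"
    and convex_f: "convex_on (X i) (f i)"
    and convex_g: "convex_on (X i) (\<lambda>v. g i v $ j)"
    and affine_h: "affine_map_on (X i) (h i)"
    and psd_PA: "psd PA" and psd_PHt: "psd PHt"
    and pos_def_D: "pos_def (PA + \<rho> *\<^sub>R PH)"
    and PH_ge_PHt: "psd (PH - PHt)"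
    and null_PH: "null_space PH = span {vec 1}"
    and null_PHt: "null_space PHt = span {vec 1}"
    and diagonal_D: "diagonal (PA + \<rho> *\<^sub>R PH)"
    and rho_pos: "\<rho> > 0"
    and pair: "primal_dual_optimal X f g h xs \<mu>s \<nu>s"
    and iterates: "duca \<rho> PA PH PHt X f g h x y z"
begin

definition A :: "real^('n \<times> ('m + 'p))^('n \<times> ('m + 'p))" where "A = kron PA (mat 1)"
definition R :: "real^('n \<times> ('m + 'p))^('n \<times> ('m + 'p))" where "R = psd_sqrt (kron PHt (mat 1))"
definition ys :: "real^('n \<times> ('m + 'p))" where "ys = blocks (\<lambda>_. stack \<mu>s \<nu>s)"
definition zs :: "real^('n \<times> ('m + 'p))" where "zs = pinv R *v gtilde g h xs"

abbreviation "G \<equiv> block_diag A ((1 / \<rho>) *\<^sub>R mat 1)"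

text \<open>The residual of the projection defining \<open>y (Suc k)\<close>, a normal vector to \<open>Kset\<close> at
  \<open>y (Suc k)\<close>, rewritten with the update of \<open>z\<close>.\<close>

definition resid :: "nat \<Rightarrow> real^('n \<times> ('m + 'p))" where
  "resid k = A *v (y k - y (Suc k)) - R *v z (Suc k)
     - \<rho> *\<^sub>R (kron (PH - PHt) (mat 1) *v y (Suc k)) + gtilde g h (x (Suc k))"

lemma D_diag_pos: "0 < (PA + \<rho> *\<^sub>R PH) $ i $ i"
proof -
  have "axis i 1 \<bullet> ((PA + \<rho> *\<^sub>R PH) *v axis i 1) = (PA + \<rho> *\<^sub>R PH) $ i $ i"
    by (simp add: matrix_vector_mult_basis inner_axis' column_def)
  then show ?thesis using pos_def_D by (metis pos_def_def axis_eq_0_iff one_neq_zero)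
qed

lemma psd_A: "psd A"
  unfolding A_def by (rule psd_kron[OF psd_PA])

lemma sym_A: "transpose A = A"
  using psd_A by (simp add: psd_def)

lemma sym_R: "transpose R = R"
  unfolding R_def by (rule psd_sqrt_symmetric[OF psd_kron[OF psd_PHt]])

lemma one_null: "vec 1 \<in> null_space PH" "vec 1 \<in> null_space PHt"
  by (simp_all add: null_PH null_PHt span_base)

lemma iterates_Suc:
  defines "w k \<equiv> A *v y k - R *v z k + gtilde g h (x (Suc k))"
  shows "x (Suc k) \<in> prod_set X"
    and "u \<in> prod_set X \<Longrightarrow> tot f (x (Suc k)) + y (Suc k) \<bullet> gtilde g h (x (Suc k))
      \<le> tot f u + y (Suc k) \<bullet> gtilde g h u"
    and "y (Suc k) $ (i, s) = closest_point Kset (w k) $ (i, s) / (PA + \<rho> *\<^sub>R PH) $ i $ i"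
    and "z (Suc k) = z k + \<rho> *\<^sub>R (R *v y (Suc k))"
proof -
  have min: "is_arg_min (\<lambda>u. tot f u + (1/2) * (wnorm (matrix_inv (kron (PA + \<rho> *\<^sub>R PH) (mat 1)))
      (closest_point Kset (A *v y k - R *v z k + gtilde g h u)))\<^sup>2) (\<lambda>u. u \<in> prod_set X) (x (Suc k))"
    and y: "y (Suc k) = closest_point Kset (matrix_inv (kron (PA + \<rho> *\<^sub>R PH) (mat 1)) *v w k)"
    and z: "z (Suc k) = z k + \<rho> *\<^sub>R (R *v y (Suc k))"
    using iterates by (simp_all add: duca_def Let_def A_def R_def w_def kron_add_scaleR)
  show "x (Suc k) \<in> prod_set X" using min by (simp add: is_arg_min_def)
  show "z (Suc k) = z k + \<rho> *\<^sub>R (R *v y (Suc k))" by (rule z)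
  show "y (Suc k) $ (i, s) = closest_point Kset (w k) $ (i, s) / (PA + \<rho> *\<^sub>R PH) $ i $ i"
    unfolding y by (rule closest_point_Kset_scaled[OF diagonal_D D_diag_pos])
  show "tot f (x (Suc k)) + y (Suc k) \<bullet> gtilde g h (x (Suc k))
      \<le> tot f u + y (Suc k) \<bullet> gtilde g h u" if "u \<in> prod_set X"
    unfolding y w_def
    by (rule primal_step[OF convex_X convex_f convex_g affine_h diagonal_D D_diag_pos min that])
qed

text \<open>Inserting the update of \<open>z\<close> replaces \<open>R *v z k\<close> by
  \<open>R *v z (Suc k)\<close> and a multiple of \<open>kron PHt (mat 1) *v y (Suc k)\<close>.
  Together with the \<open>PH\<close> part of the weight matrix this leaves the difference
  \<open>PH - PHt\<close>.\<close>

lemma resid_eq: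
  "resid k = A *v y k - R *v z k + gtilde g h (x (Suc k)) - kron (PA + \<rho> *\<^sub>R PH) (mat 1) *v y (Suc k)"
proof -
  have "R *v (R *v y (Suc k)) = kron PHt (mat 1) *v y (Suc k)"
    by (simp add: R_def matrix_vector_mul_assoc psd_sqrt(2)[OF psd_kron[OF psd_PHt]])
  then show ?thesis
    by (simp add: resid_def iterates_Suc(4)[of k] A_def kron_add_scaleR kron_diff
        matrix_vector_mult_diff_distrib matrix_vector_right_distrib matrix_vector_mult_scaleR
        matrix_vector_mult_add_rdistrib matrix_vector_mult_diff_rdistrib
        scaleR_matrix_vector_assoc[symmetric] scaleR_diff_right)
qed

lemma kron_D_apply:
  "(kron (PA + \<rho> *\<^sub>R PH) (mat 1) *v u) $ (i, s) = (PA + \<rho> *\<^sub>R PH) $ i $ i * u $ (i, s)"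
  for u :: "real^('n \<times> ('m + 'p))"
  by (rule kron_diagonal_apply[OF diagonal_D])

text \<open>The weight matrix maps \<open>y (Suc k)\<close> to the projection of \<open>w\<close>,
  so the residual is \<open>w\<close> minus its projection onto \<open>Kset\<close>: it lies in the
  polar cone and is complementary to the projection coordinate by coordinate.\<close>

lemma resid_cone:
  shows "resid k $ (i, Inl j) \<le> 0" "resid k $ (i, Inr l) = 0" "resid k \<bullet> y (Suc k) = 0"
    and "0 \<le> y (Suc k) $ (i, Inl j)"
proof -
  define w where "w = A *v y k - R *v z k + gtilde g h (x (Suc k))"
  have r: "resid k $ (i, s) = w $ (i, s) - closest_point Kset w $ (i, s)" for i s
    using D_diag_pos[of i]
    by (simp add: resid_eq kron_D_apply iterates_Suc(3) flip: w_def)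
  show "resid k $ (i, Inl j) \<le> 0" "resid k $ (i, Inr l) = 0"
    by (simp_all add: r closest_point_Kset)
  show "0 \<le> y (Suc k) $ (i, Inl j)"
    using D_diag_pos[of i] by (simp add: iterates_Suc(3) closest_point_Kset)
  have compl: "resid k $ (i, s) * y (Suc k) $ (i, s) = 0" for i s
    by (cases s) (simp_all add: r iterates_Suc(3) closest_point_Kset max_def flip: w_def)
  show "resid k \<bullet> y (Suc k) = 0"
    unfolding inner_prod_index by (simp only: compl sum.neutral_const)
qed

lemma optimal_pair:
  shows "xs \<in> prod_set X" "tot g xs $ j \<le> 0" "tot h xs = 0" "0 \<le> \<mu>s $ j"
  using pair by (auto simp: primal_dual_optimal_def optimal_def is_arg_min_def feasible_def
      dual_optimal_def)

lemma R_ys: "R *v ys = 0"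
  unfolding R_def psd_sqrt_kron_null[OF psd_PHt]
  by (simp add: ys_def slice_blocks_const null_PHt span_scale span_base)

lemma kron_ys: "kron (PH - PHt) (mat 1) *v ys = 0"
proof -
  have "(PH - PHt) *v vec 1 = 0"
    using one_null by (simp add: null_space_def matrix_vector_mult_diff_rdistrib)
  then show ?thesis
    by (simp add: slice_eq_iff slice_kron slice_linear ys_def slice_blocks_const
        matrix_vector_mult_scaleR)
qed

text \<open>Two inequalities are added so that the objective cancels: minimality of
  \<open>x (Suc k)\<close> in the linearised problem, tested at \<open>xs\<close>, and the saddle
  inequality, tested at \<open>x (Suc k)\<close>. What remains is compared with
  \<open>R *v zs\<close>, which is \<open>gtilde g h xs\<close> without its agent average.\<close>

lemma inner_gtilde_le: "gtilde g h (x (Suc k)) \<bullet> (y (Suc k) - ys) \<le> zs \<bullet> (R *v y (Suc k))"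
proof -
  \<comment> \<open>The average part has a favourable sign: nonnegative multipliers meet
    \<open>tot g xs\<close>, which is nonpositive, and \<open>tot h xs\<close> vanishes.\<close>
  have "agent_sum (y (Suc k)) \<bullet> agent_sum (gtilde g h xs) \<le> 0"
    unfolding agent_sum_gtilde optimal_pair(3) inner_vec_def
  proof (rule sum_nonpos)
    fix s :: "'m + 'p"
    show "agent_sum (y (Suc k)) $ s \<bullet> stack (tot g xs) 0 $ s \<le> 0"
      by (cases s) (simp_all add: stack_def agent_sum_def optimal_pair(2) resid_cone(4)
          mult_nonneg_nonpos sum_nonneg)
  qed
  then have "y (Suc k) \<bullet> gtilde g h xs \<le> y (Suc k) \<bullet> (R *v zs)"
    unfolding zs_def R_def inner_psd_sqrt_pinv[OF psd_PHt null_PHt] by (simp add: divide_le_0_iff)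
  also have "\<dots> = zs \<bullet> (R *v y (Suc k))"
    using symmetric_inner[OF sym_R, of "y (Suc k)" zs] by (simp add: inner_commute)
  finally have "y (Suc k) \<bullet> gtilde g h xs \<le> zs \<bullet> (R *v y (Suc k))" .
  moreover have "tot f (x (Suc k)) + y (Suc k) \<bullet> gtilde g h (x (Suc k))
      \<le> tot f xs + y (Suc k) \<bullet> gtilde g h xs"
    by (rule iterates_Suc(2)[OF optimal_pair(1)])
  moreover have "tot f xs \<le> tot f (x (Suc k)) + ys \<bullet> gtilde g h (x (Suc k))"
    unfolding ys_def by (rule primal_dual_optimal_saddle[OF pair iterates_Suc(1)])
  ultimately show ?thesis by (simp add: inner_diff_right inner_commute)
qed

lemma descent: "(y (Suc k) - ys) \<bullet> (A *v (y (Suc k) - y k)) + (z (Suc k) - zs) \<bullet> (R *v y (Suc k)) \<le> 0"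
proof -
  let ?b = "y (Suc k) - ys"
  have "resid k \<bullet> ys \<le> 0"
    unfolding inner_prod_index
  proof (intro sum_nonpos)
    fix i and s :: "'m + 'p"
    show "resid k $ (i, s) * ys $ (i, s) \<le> 0"
      using resid_cone(1,2)[of k i] optimal_pair(4)
      by (cases s) (auto simp: ys_def blocks_def stack_def mult_nonpos_nonneg)
  qed
  then have "0 \<le> resid k \<bullet> ?b" by (simp add: inner_diff_right resid_cone(3))
  moreover have "(A *v (y k - y (Suc k))) \<bullet> ?b = - (?b \<bullet> (A *v (y (Suc k) - y k)))"
    by (simp add: matrix_vector_mult_diff_distrib inner_diff_right inner_diff_left inner_commute)
  moreover have "(R *v z (Suc k)) \<bullet> ?b = z (Suc k) \<bullet> (R *v y (Suc k))"
    by (simp add: symmetric_inner[OF sym_R] matrix_vector_mult_diff_distrib R_ys)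
  moreover have "0 \<le> \<rho> * ((kron (PH - PHt) (mat 1) *v y (Suc k)) \<bullet> ?b)"
  proof (rule mult_nonneg_nonneg)
    have psd: "psd (kron (PH - PHt) (mat 1) :: real^('n \<times> ('m + 'p))^('n \<times> ('m + 'p)))"
      by (rule psd_kron[OF PH_ge_PHt])
    then have "(kron (PH - PHt) (mat 1) *v y (Suc k)) \<bullet> ?b
        = y (Suc k) \<bullet> (kron (PH - PHt) (mat 1) *v y (Suc k))"
      by (simp add: psd_def symmetric_inner matrix_vector_mult_diff_distrib kron_ys)
    then show "0 \<le> (kron (PH - PHt) (mat 1) *v y (Suc k)) \<bullet> ?b" using psd by (simp add: psd_def)
  qed (use rho_pos in simp)
  moreover have "resid k \<bullet> ?b = (A *v (y k - y (Suc k))) \<bullet> ?b - (R *v z (Suc k)) \<bullet> ?b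
      - \<rho> * ((kron (PH - PHt) (mat 1) *v y (Suc k)) \<bullet> ?b) + gtilde g h (x (Suc k)) \<bullet> ?b"
    unfolding resid_def by (simp only: inner_add_left inner_diff_left inner_scaleR_left)
  ultimately show ?thesis
    using inner_gtilde_le[of k] inner_diff_left[of "z (Suc k)" zs "R *v y (Suc k)"] by linarith
qed

text \<open>In either seminorm, the square at the new point is at most the square at the old one
  plus twice the product of the new point with the increment. As the increment of \<open>z\<close>
  carries a factor \<rho>, the weight \<open>1 / \<rho>\<close> in \<open>G\<close> makes these
  products add up to the left side of \<open>descent\<close>.\<close>

lemma fejer: "(wnorm G (stack (y (Suc k)) (z (Suc k)) - stack ys zs))\<^sup>2
    \<le> (wnorm G (stack (y k) (z k) - stack ys zs))\<^sup>2"
proof -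
  define a b \<alpha> \<beta> where "a = y k - ys" "b = y (Suc k) - ys" "\<alpha> = z k - zs" "\<beta> = z (Suc k) - zs"
  note defs = this
  have ba: "b - a = y (Suc k) - y k" "\<beta> - \<alpha> = \<rho> *\<^sub>R (R *v y (Suc k))"
    by (simp_all add: defs iterates_Suc(4)[of k])
  have "0 \<le> (b - a) \<bullet> (A *v (b - a))"
    using psd_A unfolding psd_def by blast
  moreover have "b \<bullet> (A *v a) = a \<bullet> (A *v b)"
    by (metis inner_commute sym_A symmetric_inner)
  ultimately have "b \<bullet> (A *v b) \<le> a \<bullet> (A *v a) + 2 * (b \<bullet> (A *v (b - a)))"
    by (simp add: matrix_vector_mult_diff_distrib inner_diff_left inner_diff_right)
  moreover have "\<beta> \<bullet> \<beta> \<le> \<alpha> \<bullet> \<alpha> + 2 * (\<beta> \<bullet> (\<beta> - \<alpha>))"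
    using inner_ge_zero[of "\<beta> - \<alpha>"] by (simp add: inner_diff_left inner_diff_right inner_commute)
  then have "1 / \<rho> * (\<beta> \<bullet> \<beta>) \<le> 1 / \<rho> * (\<alpha> \<bullet> \<alpha>) + 2 * (\<beta> \<bullet> (R *v y (Suc k)))"
    using rho_pos by (simp add: ba field_simps)
  moreover have "b \<bullet> (A *v (b - a)) + \<beta> \<bullet> (R *v y (Suc k)) \<le> 0"
    using descent[of k] by (simp add: ba) (simp add: defs)
  ultimately have "b \<bullet> (A *v b) + 1 / \<rho> * (\<beta> \<bullet> \<beta>) \<le> a \<bullet> (A *v a) + 1 / \<rho> * (\<alpha> \<bullet> \<alpha>)"
    by linarith
  then show ?thesis
    using rho_pos by (simp add: stack_diff wnorm_block_diag psd_A flip: defs)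
qed

text \<open>Both distances in the final bound arise here: \<open>y k - y 0\<close> is split at
  \<open>ys\<close>, and the distance from \<open>y k\<close> to \<open>ys\<close> is dominated by
  the nonincreasing \<open>G\<close> distance, of which it is one part.\<close>

lemma wnorm_y_diff_le:
  "wnorm A (y k - y 0) \<le> wnorm A (y 0 - ys) + wnorm G (stack (y 0) (z 0) - stack ys zs)"
proof -
  have "(wnorm A (y k - ys))\<^sup>2 \<le> (wnorm G (stack (y k) (z k) - stack ys zs))\<^sup>2"
    using psd_A rho_pos by (simp add: stack_diff wnorm_block_diag) (simp add: wnorm_def psd_def)
  also have "\<dots> \<le> (wnorm G (stack (y 0) (z 0) - stack ys zs))\<^sup>2"
    by (induction k) (auto intro: order_trans[OF fejer])
  finally have "wnorm A (y k - ys) \<le> wnorm G (stack (y 0) (z 0) - stack ys zs)"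
    by (rule power2_le_imp_le) (simp add: wnorm_block_diag_nonneg psd_A rho_pos less_imp_le stack_diff)
  moreover have "wnorm A (y k - y 0) \<le> wnorm A (y k - ys) + wnorm A (y 0 - ys)"
    using wnorm_diff_triangle[OF psd_A, of "y k - ys" "y 0 - ys"] by simp
  ultimately show ?thesis by simp
qed

section \<open>Accumulated constraint violation\<close>

lemma agent_sum_resid:
  "agent_sum (resid k) = stack (tot g (x (Suc k))) (tot h (x (Suc k)))
    - agent_sum (A *v (y (Suc k) - y k))"
proof -
  have "transpose (PH - PHt) = PH - PHt" using PH_ge_PHt by (simp add: psd_def)
  moreover have "vec 1 \<in> null_space (PH - PHt)"
    using one_null by (simp add: null_space_def matrix_vector_mult_diff_rdistrib)
  ultimately have "agent_sum (kron (PH - PHt) (mat 1) *v y (Suc k)) = 0"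
    by (rule agent_sum_kron_eq_0)
  moreover have "agent_sum (R *v z (Suc k)) = 0"
    unfolding R_def by (rule agent_sum_psd_sqrt_kron[OF psd_PHt one_null(2)])
  moreover have "A *v (y k - y (Suc k)) = - (A *v (y (Suc k) - y k))"
    by (simp add: matrix_vector_mult_diff_distrib)
  ultimately show ?thesis
    by (simp add: resid_def linear_add[OF linear_agent_sum] linear_diff[OF linear_agent_sum]
        linear_scale[OF linear_agent_sum] linear_neg[OF linear_agent_sum] agent_sum_gtilde)
qed

text \<open>The iterate \<open>x l\<close> is paired with the increment from
  \<open>y (l - 1)\<close> to \<open>y l\<close>, so sums starting at \<open>l = 1\<close> telescope
  exactly to \<open>e k\<close>, with \<open>e 0 = 0\<close>.\<close>

lemma sum_constraints:
  defines "e k \<equiv> agent_sum (A *v (y k - y 0))"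
  shows "(\<Sum>l=1..k. tot g (x l) $ j) \<le> e k $ Inl j" "(\<Sum>l=1..k. tot h (x l) $ i) = e k $ Inr i"
proof -
  have e: "e (Suc k) = e k + agent_sum (A *v (y (Suc k) - y k))" for k
    unfolding e_def by (simp add: matrix_vector_mult_diff_distrib linear_diff[OF linear_agent_sum])
  have e0: "e 0 = 0" by (simp add: e_def linear_0[OF linear_agent_sum])
  have step: "agent_sum (resid k) $ Inl j \<le> 0" "agent_sum (resid k) $ Inr i = 0" for k
    by (simp_all add: agent_sum_def resid_cone sum_nonpos)
  have g: "tot g (x (Suc k)) $ j \<le> e (Suc k) $ Inl j - e k $ Inl j"
    and h: "tot h (x (Suc k)) $ i = e (Suc k) $ Inr i - e k $ Inr i" for k
    using step[of k] by (simp_all add: agent_sum_resid stack_def e)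
  show "(\<Sum>l=1..k. tot g (x l) $ j) \<le> e k $ Inl j"
  proof (induction k)
    case (Suc k)
    then show ?case using g[of k] by simp
  qed (simp add: e0)
  show "(\<Sum>l=1..k. tot h (x l) $ i) = e k $ Inr i"
  proof (induction k)
    case (Suc k)
    then show ?case using h[of k] by simp
  qed (simp add: e0)
qed

theorem constraint_violation_le:
  assumes "1 \<le> k"
  shows "norm (stack (pos_part (tot g (running_avg x k))) (tot h (running_avg x k)))
    \<le> sqrt (real CARD('n) * largest_eigenvalue PA) / real k
       * (wnorm A (y 0 - ys) + wnorm G (stack (y 0) (z 0) - stack ys zs))"
proof -
  define e where "e = agent_sum (A *v (y k - y 0))"
  have x: "x l \<in> prod_set X" if "1 \<le> l" for l
    \<comment> \<open>Membership holds from index 1 on, as each update produces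
      \<open>x (Suc k)\<close>; hence the shift by one.\<close>
    using iterates_Suc(1)[of "l - 1"] that by simp
  have "norm (stack (pos_part (tot g (running_avg x k))) (tot h (running_avg x k)))
      \<le> norm ((1 / real k) *\<^sub>R e)"
  proof (rule norm_le_componentwise_cart)
    fix s
    show "norm (stack (pos_part (tot g (running_avg x k))) (tot h (running_avg x k)) $ s)
        \<le> norm (((1 / real k) *\<^sub>R e) $ s)"
    proof (cases s)
      case (Inl j)
      have "tot g (running_avg x k) $ j \<le> (\<Sum>l=1..k. tot g (x l) $ j) / real k"
        by (rule convex_on_running_avg[OF convex_g x assms])
      also have "\<dots> \<le> e $ Inl j / real k"
        unfolding e_def by (intro divide_right_mono sum_constraints) simp
      \<comment> \<open>With the absolute value the bound becomes nonnegative and therefore also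
        dominates the positive part.\<close>
      also have "\<dots> \<le> \<bar>e $ Inl j\<bar> / real k"
        by (intro divide_right_mono) auto
      finally have "tot g (running_avg x k) $ j \<le> \<bar>e $ Inl j\<bar> / real k" .
      then show ?thesis by (simp add: Inl stack_def pos_part_def)
    next
      case (Inr i)
      have "tot h (running_avg x k) $ i = e $ Inr i / real k"
        using affine_running_avg[OF affine_h convex_X x assms] sum_constraints(2)[where i = i and k = k]
        by (simp add: e_def)
      then show ?thesis by (simp add: Inr stack_def)
    qed
  qed
  also have "\<dots> = norm e / real k" by simp
  also have "norm e \<le> sqrt (real CARD('n) * largest_eigenvalue PA) * wnorm A (y k - y 0)"
    unfolding e_def A_def by (rule norm_agent_sum_kron_le[OF psd_PA])
  also have "\<dots> \<le> sqrt (real CARD('n) * largest_eigenvalue PA)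
      * (wnorm A (y 0 - ys) + wnorm G (stack (y 0) (z 0) - stack ys zs))"
    by (intro mult_left_mono wnorm_y_diff_le) (simp add: largest_eigenvalue_nonneg[OF psd_PA])
  finally show ?thesis by (simp add: divide_right_mono)
qed

end

theorem theorem2:
  fixes J :: "'n::finite \<Rightarrow> 'd::finite set"
    and X :: "'n \<Rightarrow> (real^'d) set"
    and f :: "'n \<Rightarrow> real^'d \<Rightarrow> real"
    and g :: "'n \<Rightarrow> real^'d \<Rightarrow> real^'m"
    and h :: "'n \<Rightarrow> real^'d \<Rightarrow> real^'p"
    and PA PH PHt :: "real^'n^'n"
    and \<rho> :: real
    and xs :: "real^'d^'n" and \<mu>s :: "real^'m" and \<nu>s :: "real^'p"
    and x :: "nat \<Rightarrow> real^'d^'n"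
    and y z :: "nat \<Rightarrow> real^('n \<times> ('m + 'p))"
  assumes dims: "\<And>i. X i \<subseteq> coord_space (J i)"
    and convex_X: "\<And>i. convex (X i)"
    and convex_f: "\<And>i. convex_on (X i) (f i)"
    and convex_g: "\<And>i j. convex_on (X i) (\<lambda>v. g i v $ j)"
    and affine_h: "\<And>i. affine_map_on (X i) (h i)"
    and solvable: "\<exists>u. optimal X f g h u"
    and slater: "\<exists>xt. (\<forall>i. xt $ i \<in> rel_interior (X i)) \<and> (\<forall>j. tot g xt $ j < 0) \<and> tot h xt = 0"
    and psd_PA: "psd PA" and psd_PH: "psd PH" and psd_PHt: "psd PHt"
    and pos_def_D: "pos_def (PA + \<rho> *\<^sub>R PH)"
    and PH_ge_PHt: "psd (PH - PHt)"
    and null_PH: "null_space PH = span {vec 1}"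
    and null_PHt: "null_space PHt = span {vec 1}"
    and compact_X: "\<And>i. compact (X i)"
    and diagonal_D: "diagonal (PA + \<rho> *\<^sub>R PH)"
    and rho_pos: "\<rho> > 0"
    and pair: "primal_dual_optimal X f g h xs \<mu>s \<nu>s"
    and iterates: "duca \<rho> PA PH PHt X f g h x y z"
  shows "\<forall>k\<ge>1.
    (let A = kron PA (mat 1);
         G = block_diag A ((1 / \<rho>) *\<^sub>R mat 1);
         ys = blocks (\<lambda>_. stack \<mu>s \<nu>s);
         zs = pinv (psd_sqrt (kron PHt (mat 1))) *v gtilde g h xs;
         xbar = running_avg x k
     in norm (stack (pos_part (tot g xbar)) (tot h xbar))
        \<le> sqrt (real CARD('n) * largest_eigenvalue PA) / real k
           * (wnorm A (y 0 - ys) + wnorm G (stack (y 0) (z 0) - stack ys zs)))"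
proof -
  interpret duca_run X f g h PA PH PHt \<rho> xs \<mu>s \<nu>s x y z
    by unfold_locales (fact convex_X convex_f convex_g affine_h psd_PA psd_PHt pos_def_D
        PH_ge_PHt null_PH null_PHt diagonal_D rho_pos pair iterates)+
  show ?thesis
    using constraint_violation_le by (simp add: Let_def A_def R_def ys_def zs_def)
qed

end
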